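(* Let $p\in(1,\infty)$, let $w\in A_p$ be a Muckenhoupt weight on $\mathbb{R}^n$ and let $v\in C_c^\infty(\mathbb{R}^n)$. Then there is a constant $C\ge 1$ depending only on $n$, $p$, $[w]_{A_p}$, $\lambda$ and $\Lambda$ such that $$C^{-1}\int_{\mathbb{R}^n}|v(x)|^p w(x)\,dx\le \liminf_{s\searrow 0}\mathcal{J}^s_{p,w}(v)\le \limsup_{s\searrow 0}\mathcal{J}^s_{p,w}(v)\le C\int_{\mathbb{R}^n}|v(x)|^p w(x)\,dx$$ and $$C^{-1}\int_{\mathbb{R}^n}|\nabla v(x)|^p w(x)\,dx\le \liminf_{s\nearrow 1}\mathcal{J}^s_{p,w}(v)\le \limsup_{s\nearrow 1}\mathcal{J}^s_{p,w}(v)\le C\int_{\mathbb{R}^n}|\nabla v(x)|^p w(x)\,dx .$$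
   Context: Throughout $n\ge 2$. A weight is a function $w\in L^1_{\mathrm{loc}}(\mathbb{R}^n)$ with $w>0$ a.e.; $w(U)=\int_U w\,dx$ for measurable $U$. For $1<p<\infty$, $w\in A_p$ means $$[w]_{A_p}:=\sup_{B}\Big(\frac1{|B|}\int_B w\,dx\Big)\Big(\frac1{|B|}\int_B w^{\frac1{1-p}}dx\Big)^{p-1}<\infty,$$ the supremum being over all balls $B\subset\mathbb{R}^n$. For $x,y\in\mathbb{R}^n$ let $B_{x,y}$ be the ball with center $\frac{x+y}2$ and radius $\frac12|x-y|$. Let $0<\lambda\le\Lambda<\infty$ and let $k:\mathbb{R}^n\times\mathbb{R}^n\to[0,\infty)$ be a measurable kernel with $$\lambda\frac{w(x)w(y)}{w(B_{x,y})}\le k(x,y)\le\Lambda\frac{w(x)w(y)}{w(B_{x,y})}.$$ For $s\in(0,1)$ and $v\in L^1_{\mathrm{loc}}(\mathbb{R}^n)$ set $$\mathcal{J}^s_{p,w}(v)=s(1-s)\int_{\mathbb{R}^n}\int_{\mathbb{R}^n}\Big(\frac{|v(x)-v(y)|}{|x-y|^s}\Big)^p k(x,y)\,dx\,dy.$$ *)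

theory Defs
  imports "HOL-Analysis.Analysis"
begin

definition L1_loc :: "(real^'n \<Rightarrow> real) \<Rightarrow> bool" where
  "L1_loc f \<longleftrightarrow> (\<forall>K. compact K \<longrightarrow> f absolutely_integrable_on K)"

definition weight :: "(real^'n \<Rightarrow> real) \<Rightarrow> bool" where
  "weight w \<longleftrightarrow> L1_loc w \<and> (AE x in lebesgue. 0 < w x)"

(* A weight is nonnegative almost everywhere, so the truncation of negative values
   by the coercion to ennreal does not affect any of the integrals below. *)

definition wmeasure :: "(real^'n \<Rightarrow> real) \<Rightarrow> (real^'n) set \<Rightarrow> ennreal" where
  "wmeasure w U = (\<integral>\<^sup>+x\<in>U. ennreal (w x) \<partial>lebesgue)"

(* Only used with a > 0, where the power of infinity is infinity. *)

definition epowr :: "ennreal \<Rightarrow> real \<Rightarrow> ennreal" where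
  "epowr x a = (if x = \<infinity> then \<infinity> else ennreal (enn2real x powr a))"

definition average :: "(real^'n) set \<Rightarrow> (real^'n \<Rightarrow> real) \<Rightarrow> ennreal" where
  "average B f = (\<integral>\<^sup>+x\<in>B. ennreal (f x) \<partial>lebesgue) / emeasure lebesgue B"

definition Ap_const :: "real \<Rightarrow> (real^'n \<Rightarrow> real) \<Rightarrow> ennreal" where
  "Ap_const p w =
     (SUP B\<in>{ball c r | c r. 0 < r}.
        average B w * epowr (average B (\<lambda>x. w x powr (1 / (1 - p)))) (p - 1))"

definition Ap :: "real \<Rightarrow> (real^'n \<Rightarrow> real) set" where
  "Ap p = {w. weight w \<and> Ap_const p w < \<infinity>}"

definition midball :: "real^'n \<Rightarrow> real^'n \<Rightarrow> (real^'n) set" where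
  "midball x y = ball (midpoint x y) (norm (x - y) / 2)"

(* A weight is only determined up to null sets and the ball is degenerate for x = y,
   so the two-sided bound is required for almost every pair (x, y) with respect to
   Lebesgue measure on the product space. *)

definition admissible_kernel ::
  "real \<Rightarrow> real \<Rightarrow> (real^'n \<Rightarrow> real) \<Rightarrow> (real^'n \<Rightarrow> real^'n \<Rightarrow> real) \<Rightarrow> bool" where
  "admissible_kernel lam Lam w k \<longleftrightarrow>
     (\<lambda>(x, y). k x y) \<in> borel_measurable lebesgue \<and>
     (\<forall>x y. 0 \<le> k x y) \<and>
     (AE (x, y) in lebesgue.
        ennreal lam * (ennreal (w x) * ennreal (w y) / wmeasure w (midball x y))
          \<le> ennreal (k x y) \<and>
        ennreal (k x y)
          \<le> ennreal Lam * (ennreal (w x) * ennreal (w y) / wmeasure w (midball x y)))"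

definition energy ::
  "real \<Rightarrow> (real^'n \<Rightarrow> real^'n \<Rightarrow> real) \<Rightarrow> (real^'n \<Rightarrow> real) \<Rightarrow> real \<Rightarrow> ennreal" where
  "energy p k v s =
     ennreal (s * (1 - s)) *
     (\<integral>\<^sup>+y. (\<integral>\<^sup>+x. ennreal ((\<bar>v x - v y\<bar> / norm (x - y) powr s) powr p * k x y)
        \<partial>lebesgue) \<partial>lebesgue)"

definition partial :: "'n \<Rightarrow> (real^'n \<Rightarrow> real) \<Rightarrow> real^'n \<Rightarrow> real" where
  "partial i f x = frechet_derivative f (at x) (axis i 1)"

definition grad :: "(real^'n \<Rightarrow> real) \<Rightarrow> real^'n \<Rightarrow> real^'n" where
  "grad f x = (\<chi> i. partial i f x)"

primrec C_k :: "nat \<Rightarrow> (real^'n \<Rightarrow> real) \<Rightarrow> bool" where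
  "C_k 0 f \<longleftrightarrow> continuous_on UNIV f"
| "C_k (Suc m) f \<longleftrightarrow> (\<forall>x. f differentiable (at x)) \<and> (\<forall>i. C_k m (partial i f))"

definition Cc_infty :: "(real^'n \<Rightarrow> real) set" where
  "Cc_infty = {v. (\<forall>m. C_k m v) \<and> compact (closure {x. v x \<noteq> 0})}"

end

theory Submission
  imports Defs "HOL-Real_Asymp.Real_Asymp"
begin

text \<open>
  For a Muckenhoupt weight \<open>w\<close> the measure \<open>d\<mu> = w dx\<close> is doubling, and the theorem is really one
  about doubling measures.  The kernel turns the energy into
  \<open>\<integral>\<integral> |v x - v y|^p / |x - y|^(s p) / \<mu>(B_{x,y}) d\<mu>(y) d\<mu>(x)\<close>, up to the factors \<open>lam\<close> and \<open>Lam\<close>.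

  Fix \<open>x\<close> and cut the inner integral into dyadic shells around \<open>x\<close>.  By doubling
  \<open>\<mu>(B_{x,y})\<close> is comparable, for \<open>y\<close> in a shell, with the measure of a ball that contains the
  shell, so each shell has mass between \<open>1/D\<close> and \<open>D\<close> with respect to \<open>d\<mu>(y) / \<mu>(B_{x,y})\<close>.
  The lower bound survives if the shell is cut down to a cone around any axis, because the cone
  still contains a ball of comparable size.  Hence
  \<open>\<integral>_{|x-y| \<ge> R} |x - y|^(-s p) d\<mu>(y) / \<mu>(B_{x,y})\<close> and
  \<open>\<integral>_{|x-y| < R} |x - y|^((1-s) p) d\<mu>(y) / \<mu>(B_{x,y})\<close> are comparable with the geometric series
  with ratios \<open>2^(-s p)\<close> and \<open>2^(-(1-s) p)\<close>.  The sums blow up like \<open>1/s\<close> and \<open>1/(1-s)\<close>, and this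
  is what the factor \<open>s (1 - s)\<close> normalises: \<open>t / (1 - 2^(-t p))\<close> tends to \<open>1 / (p ln 2)\<close>.

  As \<open>s\<close> decreases to \<open>0\<close> only the distant pairs contribute.  There \<open>|v x - v y|^p\<close> is at most
  \<open>2^p (|v x|^p + |v y|^p)\<close>, and it equals \<open>|v x|^p\<close> as soon as \<open>x\<close> lies in the support of \<open>v\<close> and
  \<open>y\<close> is far away.  As \<open>s\<close> increases to \<open>1\<close> only the close pairs contribute.  There
  \<open>v x - v y\<close> differs from \<open>grad v x \<bullet> (x - y)\<close> by at most \<open>\<epsilon> |x - y|\<close>, uniformly in \<open>x\<close>, which gives
  the upper bound directly and the lower bound on the cone around \<open>grad v x\<close>.

  The main steps are \<open>nn_integral_shell_le\<close> and \<open>nn_integral_shell_cone_ge\<close> for the shells,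
  \<open>energy_le_far_plus_near\<close>, \<open>energy_ge_far\<close> and \<open>energy_ge_near\<close> for the energy at a fixed \<open>s\<close>,
  \<open>energy_limits\<close> for the passage to the limits, and \<open>Ap_doubling\<close> together with
  \<open>energy_sandwich\<close> for the return to weights and kernels.
\<close>

section \<open>Doubling measures, dyadic shells and cones\<close>

lemma inverse_le_of_le_cmult:
  fixes b m :: ennreal
  assumes "b \<le> ennreal D * m" "0 < b" "b < \<infinity>" "m < \<infinity>"
  shows "1 / m \<le> ennreal D / b"
  using assms
proof (cases b)
  case (real r)
  show ?thesis
  proof (cases m)
    case (real m')
    have D: "0 \<le> D" using assms(1,2) by (cases "0 \<le> D") (auto simp: ennreal_neg)
    have "r \<le> D * m'" "0 < r"
      using assms real \<open>b = ennreal r\<close> \<open>0 \<le> r\<close> D by (auto simp: ennreal_mult[symmetric])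
    moreover from this have "0 < m'" using real D by (cases "m' = 0") auto
    ultimately have "1 / m' \<le> D / r" by (simp add: field_simps)
    then show ?thesis using \<open>0 < r\<close> \<open>0 < m'\<close> D real \<open>b = ennreal r\<close>
      by (simp add: divide_ennreal ennreal_leI flip: ennreal_1)
  qed (use assms in auto)
qed (use assms in auto)

lemma powr_dyadic_up:
  fixes R t :: real
  assumes "0 < R"
  shows "(R * 2 ^ j) powr t = R powr t * (2 powr t) ^ j"
proof -
  have "(2 ^ j) powr t = (2 powr t :: real) ^ j"
    by (induction j) (simp_all add: powr_mult)
  then show ?thesis using assms by (simp add: powr_mult)
qed
lemma powr_dyadic_down:
  fixes R t :: real
  assumes "0 < R"
  shows "(R / 2 ^ j) powr t = R powr t * (2 powr (- t)) ^ j"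
proof -
  have "(2 ^ j) powr t = (2 powr t :: real) ^ j"
    by (induction j) (simp_all add: powr_mult)
  then show ?thesis using assms by (simp add: powr_divide powr_minus power_inverse divide_simps)
qed

text \<open>
  The shell is parametrised by an eighth of its outer radius: \<open>r\<close> is the radius of the small balls
  to which the doubling inequality is applied.
\<close>

definition shell :: "real^'n \<Rightarrow> real \<Rightarrow> (real^'n) set" where
  "shell x r = {y. 4 * r \<le> dist x y \<and> dist x y < 8 * r}"

text \<open>
  The double cone with vertex \<open>x\<close> and axis \<open>e\<close>, for a unit vector \<open>e\<close>, of half-angle 60 degrees.
\<close>

definition cone :: "real^'n \<Rightarrow> real^'n \<Rightarrow> (real^'n) set" where
  "cone x e = {y. dist x y / 2 \<le> \<bar>e \<bullet> (y - x)\<bar>}"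

lemma disjoint_shells:
  assumes "\<And>i j. i < j \<Longrightarrow> 2 * \<rho> i \<le> (\<rho> j :: real) \<or> 2 * \<rho> j \<le> \<rho> i"
  shows "disjoint_family (\<lambda>j::nat. shell x (\<rho> j))"
proof (unfold disjoint_family_on_def, intro ballI impI)
  fix i j :: nat assume "i \<noteq> j"
  then show "shell x (\<rho> i) \<inter> shell x (\<rho> j) = {}"
  proof (induction i j rule: linorder_wlog)
    case (le i j)
    then show ?case using assms[of i j] by (auto simp: shell_def)
  qed auto
qed

lemma sum_geometric_ennreal:
  assumes "0 \<le> q" "q < 1" "0 \<le> M"
  shows "(\<Sum>j::nat. ennreal (M * q ^ j)) = ennreal (M / (1 - q))"
proof (rule suminf_ennreal_eq)
  show "(\<lambda>j. M * q ^ j) sums (M / (1 - q))"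
    using sums_mult[OF geometric_sums[of q], of M] assms by simp
qed (use assms in simp)

lemma midball_commute: "midball x y = midball y x"
  by (simp add: midball_def midpoint_sym norm_minus_commute)

text \<open>
  For \<open>x = y\<close> both sides vanish because \<open>0 powr p = 0\<close>.
\<close>

lemma quotient_powr:
  fixes x y :: "real^'n" and v :: "real^'n \<Rightarrow> real"
  shows "(\<bar>v x - v y\<bar> / norm (x - y) powr s) powr p = \<bar>v x - v y\<bar> powr p * dist x y powr (- (s * p))"
proof -
  have "(\<bar>v x - v y\<bar> / norm (x - y) powr s) powr p = \<bar>v x - v y\<bar> powr p / dist x y powr (s * p)"
    by (simp add: dist_norm powr_divide powr_powr)
  then show ?thesis by (simp add: powr_minus divide_inverse)
qed

lemma powr_add_le:
  fixes a b p :: real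
  assumes "0 \<le> a" "0 \<le> b" "0 < p"
  shows "(a + b) powr p \<le> 2 powr p * (a powr p + b powr p)"
proof -
  have "(a + b) powr p \<le> (2 * max a b) powr p" using assms by (intro powr_mono2) auto
  also have "\<dots> = 2 powr p * max a b powr p" using assms by (simp add: powr_mult)
  also have "max a b powr p \<le> a powr p + b powr p" by (simp add: max_def)
  finally show ?thesis by simp
qed

text \<open>
  The ball of radius \<open>8 r\<close> need not be concentric with the small ball, since the small balls used
  below sit inside a dyadic shell around the centre of the large one.  The ratio \<open>8\<close> is what
  these configurations need.
\<close>

locale doubling_measure =
  fixes \<mu> :: "(real^'n) measure" and D :: real
  assumes sets_eq_borel [measurable_cong]: "sets \<mu> = sets borel"
    and ball_pos: "\<And>x r. 0 < r \<Longrightarrow> 0 < emeasure \<mu> (ball x r)"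
    and ball_finite: "\<And>x r. emeasure \<mu> (ball x r) < \<infinity>"
    and doubling: "\<And>a b r. 0 < r \<Longrightarrow> ball a r \<subseteq> ball b (8 * r) \<Longrightarrow>
       emeasure \<mu> (ball b (8 * r)) \<le> ennreal D * emeasure \<mu> (ball a r)"
begin

lemma D_pos: "0 < D"
proof (rule ccontr)
  assume "\<not> 0 < D"
  then have "emeasure \<mu> (ball 0 (8 * 1)) \<le> 0"
    using doubling[of 1 0 0] by (simp add: ennreal_neg subset_ball)
  with ball_pos[of "8 * 1" 0] show False by simp
qed

sublocale sigma_finite_measure \<mu>
proof
  show "\<exists>A. countable A \<and> A \<subseteq> sets \<mu> \<and> \<Union>A = space \<mu> \<and> (\<forall>a\<in>A. emeasure \<mu> a \<noteq> \<infinity>)"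
  proof (intro exI conjI)
    show "countable (range (\<lambda>n::nat. ball (0::real^'n) (real n)))" by simp
    show "range (\<lambda>n::nat. ball (0::real^'n) (real n)) \<subseteq> sets \<mu>"
      by (auto simp: sets_eq_borel)
    have "space \<mu> = UNIV" using sets_eq_imp_space_eq[OF sets_eq_borel] by simp
    then show "\<Union>(range (\<lambda>n::nat. ball (0::real^'n) (real n))) = space \<mu>"
      using reals_Archimedean2 by (auto simp: dist_norm)
    show "\<forall>a\<in>range (\<lambda>n::nat. ball (0::real^'n) (real n)). emeasure \<mu> a \<noteq> \<infinity>"
      using ball_finite by (auto simp: less_top[symmetric])
  qed
qed

sublocale pair: pair_sigma_finite \<mu> \<mu> ..

text \<open>
  The measure of \<open>midball x y\<close> is the measure of a section of an open subset of the triple product.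
  Joint measurability is needed to exchange the order of integration in the energy.
\<close>

lemma measurable_midball [measurable]:
  "(\<lambda>z. emeasure \<mu> (midball (fst z) (snd z))) \<in> borel_measurable (\<mu> \<Otimes>\<^sub>M \<mu>)"
proof -
  have S: "sets (\<mu> \<Otimes>\<^sub>M \<mu>) = sets (borel :: ((real^'n) \<times> (real^'n)) measure)"
    by (subst borel_prod[symmetric]) (intro sets_pair_measure_cong sets_eq_borel)
  have T: "sets ((\<mu> \<Otimes>\<^sub>M \<mu>) \<Otimes>\<^sub>M \<mu>) = sets (borel :: (((real^'n) \<times> (real^'n)) \<times> (real^'n)) measure)"
    using sets_pair_measure_cong[OF S sets_eq_borel] by (simp only: borel_prod)
  have "open {q :: ((real^'n) \<times> (real^'n)) \<times> (real^'n).
      dist (midpoint (fst (fst q)) (snd (fst q))) (snd q) < norm (fst (fst q) - snd (fst q)) / 2}"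
    unfolding midpoint_def by (intro open_Collect_less continuous_intros) auto
  then have "{q :: ((real^'n) \<times> (real^'n)) \<times> (real^'n).
      dist (midpoint (fst (fst q)) (snd (fst q))) (snd q) < norm (fst (fst q) - snd (fst q)) / 2}
      \<in> sets ((\<mu> \<Otimes>\<^sub>M \<mu>) \<Otimes>\<^sub>M \<mu>)"
    unfolding T by simp
  from measurable_emeasure_Pair[OF this] show ?thesis
    by (simp add: midball_def ball_def vimage_def)
qed

lemma measurable_midball_Pair [measurable]:
  "(\<lambda>y. emeasure \<mu> (midball x y)) \<in> borel_measurable \<mu>"
proof -
  have sp: "space \<mu> = UNIV" using sets_eq_imp_space_eq[OF sets_eq_borel] by simp
  have "Pair x \<in> \<mu> \<rightarrow>\<^sub>M \<mu> \<Otimes>\<^sub>M \<mu>" by (rule measurable_Pair1') (simp add: sp)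
  from measurable_compose[OF this measurable_midball] show ?thesis by simp
qed

lemma sets_shell [measurable]: "shell x r \<in> sets \<mu>"
proof -
  have "shell x r = ball x (8 * r) - ball x (4 * r)" by (auto simp: shell_def)
  then show ?thesis by (simp add: sets_eq_borel)
qed

lemma sets_cone [measurable]: "cone x e \<in> sets \<mu>"
proof -
  have "closed (cone x e)" unfolding cone_def
    by (intro closed_Collect_le continuous_intros) auto
  then show ?thesis by (simp add: sets_eq_borel)
qed

text \<open>
  For \<open>y\<close> in the shell, \<open>midball x y\<close> has radius at least \<open>2 * r\<close>.  So it contains the ball of radius
  \<open>r\<close> around the midpoint, and this ball lies in \<open>ball x (8 * r)\<close>: by doubling, \<open>midball x y\<close> has
  at least the fraction \<open>1 / D\<close> of the measure of \<open>ball x (8 * r)\<close>, which contains the shell.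
\<close>

lemma nn_integral_shell_le:
  assumes r: "0 < r"
  shows "(\<integral>\<^sup>+y. indicator (shell x r) y / emeasure \<mu> (midball x y) \<partial>\<mu>) \<le> ennreal D"
proof -
  let ?B = "emeasure \<mu> (ball x (8 * r))"
  have B: "0 < ?B" "?B < \<infinity>" using ball_pos[of "8*r" x] ball_finite r by auto
  have "indicator (shell x r) y / emeasure \<mu> (midball x y)
      \<le> (ennreal D / ?B) * indicator (shell x r) y" for y
  proof (cases "y \<in> shell x r")
    case True
    then have d: "4 * r \<le> dist x y" "dist x y < 8 * r" by (auto simp: shell_def)
    have sub: "ball (midpoint x y) r \<subseteq> midball x y"
      unfolding midball_def using d r by (intro subset_ball) (simp add: dist_norm)
    have "ball (midpoint x y) r \<subseteq> ball x (8 * r)"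
      using d r by (intro ball_subset_ball_iff[THEN iffD2] disjI1) (simp add: dist_midpoint)
    then have "?B \<le> ennreal D * emeasure \<mu> (ball (midpoint x y) r)" by (rule doubling[OF r])
    also have "\<dots> \<le> ennreal D * emeasure \<mu> (midball x y)"
      using sub by (intro mult_left_mono emeasure_mono) (auto simp: midball_def sets_eq_borel)
    finally have *: "?B \<le> ennreal D * emeasure \<mu> (midball x y)" .
    have "1 / emeasure \<mu> (midball x y) \<le> ennreal D / ?B"
      by (rule inverse_le_of_le_cmult[OF * B]) (unfold midball_def, rule ball_finite)
    with True show ?thesis by simp
  qed simp
  then have "(\<integral>\<^sup>+y. indicator (shell x r) y / emeasure \<mu> (midball x y) \<partial>\<mu>)
      \<le> (\<integral>\<^sup>+y. (ennreal D / ?B) * indicator (shell x r) y \<partial>\<mu>)"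
    by (intro nn_integral_mono)
  also have "\<dots> = (ennreal D / ?B) * emeasure \<mu> (shell x r)"
    by (rule nn_integral_cmult_indicator) simp
  also have "\<dots> \<le> (ennreal D / ?B) * ?B"
    by (intro mult_left_mono emeasure_mono) (auto simp: shell_def sets_eq_borel)
  also have "\<dots> = ennreal D"
    using B by (simp add: ennreal_divide_times)
  finally show ?thesis .
qed

text \<open>
  The ball of radius \<open>r\<close> around \<open>x + (6 * r) *\<^sub>R e\<close> lies in the shell and in the cone, and \<open>midball x y\<close>
  lies in \<open>ball x (8 * r)\<close> for every \<open>y\<close> in the shell.  Doubling compares these two balls.
\<close>

lemma nn_integral_shell_cone_ge:
  assumes r: "0 < r" and e: "norm e = 1"
  shows "1 / ennreal D \<le> (\<integral>\<^sup>+y. indicator (shell x r \<inter> cone x e) y / emeasure \<mu> (midball x y) \<partial>\<mu>)"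
proof -
  let ?B = "emeasure \<mu> (ball x (8 * r))" and ?b = "ball (x + (6 * r) *\<^sub>R e) r"
  have B: "0 < ?B" "?B < \<infinity>" using ball_pos[of "8*r" x] ball_finite r by auto
  have in_ball: "y \<in> shell x r" "y \<in> cone x e" if "y \<in> ?b" for y
  proof -
    define u where "u = y - (x + (6 * r) *\<^sub>R e)"
    have u: "norm u < r" using that by (simp add: u_def dist_norm norm_minus_commute)
    have y: "y - x = (6 * r) *\<^sub>R e + u" by (simp add: u_def)
    have n6: "norm ((6 * r) *\<^sub>R e) = 6 * r" using r e by simp
    have "norm (y - x) \<le> 6 * r + norm u" unfolding y using norm_triangle_ineq n6 by metis
    moreover have "6 * r - norm u \<le> norm (y - x)"
      unfolding y using norm_diff_ineq[of "(6 * r) *\<^sub>R e" u] n6 by simp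
    moreover have "6 * r - norm u \<le> e \<bullet> (y - x)"
    proof -
      have "\<bar>e \<bullet> u\<bar> \<le> norm u" using Cauchy_Schwarz_ineq2[of e u] e by simp
      moreover have "e \<bullet> (y - x) = 6 * r + e \<bullet> u"
        unfolding y using e by (simp add: inner_add_right dot_square_norm)
      ultimately show ?thesis by linarith
    qed
    ultimately show "y \<in> shell x r" "y \<in> cone x e"
      using u r by (auto simp: shell_def cone_def dist_norm norm_minus_commute)
  qed
  have sub: "?b \<subseteq> ball x (8 * r)"
    using in_ball by (auto simp: shell_def)
  have "1 / ennreal D \<le> emeasure \<mu> ?b / ?B"
  proof -
    have "?B \<le> ennreal D * emeasure \<mu> ?b" by (rule doubling[OF r sub])
    obtain a b where ab: "?B = ennreal a" "emeasure \<mu> ?b = ennreal b" "0 \<le> a" "0 \<le> b"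
      using ball_finite by (metis ennreal_cases infinity_ennreal_def less_irrefl)
    have "a \<le> D * b" "0 < a"
      using \<open>?B \<le> ennreal D * emeasure \<mu> ?b\<close> B ab D_pos by (auto simp: ennreal_mult[symmetric])
    then have "1 / D \<le> b / a" using D_pos by (simp add: field_simps)
    then show ?thesis using ab \<open>0 < a\<close> D_pos
      by (simp add: divide_ennreal ennreal_leI flip: ennreal_1)
  qed
  also have "emeasure \<mu> ?b / ?B = (\<integral>\<^sup>+y. (1 / ?B) * indicator ?b y \<partial>\<mu>)"
    by (subst nn_integral_cmult_indicator) (auto simp: sets_eq_borel divide_ennreal_def mult.commute)
  also have "\<dots> \<le> (\<integral>\<^sup>+y. indicator (shell x r \<inter> cone x e) y / emeasure \<mu> (midball x y) \<partial>\<mu>)"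
  proof (intro nn_integral_mono)
    fix y
    show "(1 / ?B) * indicator ?b y \<le> indicator (shell x r \<inter> cone x e) y / emeasure \<mu> (midball x y)"
    proof (cases "y \<in> ?b")
      case True
      then have d: "4 * r \<le> dist x y" "dist x y < 8 * r" using in_ball by (auto simp: shell_def)
      have "midball x y \<subseteq> ball x (8 * r)"
        using d unfolding midball_def
        by (intro ball_subset_ball_iff[THEN iffD2] disjI1) (simp add: dist_norm[symmetric] dist_midpoint)
      then have "emeasure \<mu> (midball x y) \<le> ?B"
        by (intro emeasure_mono) (auto simp: sets_eq_borel)
      moreover have "0 < emeasure \<mu> (midball x y)"
        unfolding midball_def using d r by (intro ball_pos) (auto simp: dist_norm)
      moreover have "emeasure \<mu> (midball x y) < \<infinity>"
        unfolding midball_def by (rule ball_finite)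
      ultimately have "1 / ?B \<le> ennreal 1 / emeasure \<mu> (midball x y)"
        using B by (intro inverse_le_of_le_cmult) auto
      then show ?thesis using True in_ball[OF True] by simp
    qed simp
  qed
  finally show ?thesis .
qed

text \<open>
  Summation of the shell estimate against a geometric majorant.  The shells only have to cover
  the set where \<open>\<Phi>\<close> does not vanish.
\<close>

lemma nn_integral_dyadic_le:
  assumes q: "0 \<le> q" "q < 1" "0 \<le> M" and \<rho>: "\<And>j. 0 < \<rho> j"
    and le: "\<And>y. \<Phi> y \<noteq> 0 \<Longrightarrow> \<exists>j::nat. y \<in> shell x (\<rho> j) \<and> \<Phi> y \<le> ennreal (M * q ^ j)"
  shows "(\<integral>\<^sup>+y. \<Phi> y / emeasure \<mu> (midball x y) \<partial>\<mu>) \<le> ennreal (D * M / (1 - q))"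
proof -
  let ?g = "\<lambda>j y. ennreal (M * q ^ j) * (indicator (shell x (\<rho> j)) y / emeasure \<mu> (midball x y))"
  have "(\<integral>\<^sup>+y. \<Phi> y / emeasure \<mu> (midball x y) \<partial>\<mu>) \<le> (\<integral>\<^sup>+y. (\<Sum>j. ?g j y) \<partial>\<mu>)"
  proof (intro nn_integral_mono)
    fix y
    show "\<Phi> y / emeasure \<mu> (midball x y) \<le> (\<Sum>j. ?g j y)"
    proof (cases "\<Phi> y = 0")
      case False
      then obtain j where j: "y \<in> shell x (\<rho> j)" "\<Phi> y \<le> ennreal (M * q ^ j)"
        using le by blast
      then have "\<Phi> y / emeasure \<mu> (midball x y) \<le> ?g j y"
        by (simp add: divide_ennreal_def mult_right_mono)
      also have "\<dots> = (\<Sum>i\<in>{j}. ?g i y)" by simp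
      also have "\<dots> \<le> (\<Sum>j. ?g j y)" by (intro sum_le_suminf) auto
      finally show ?thesis .
    qed simp
  qed
  also have "\<dots> = (\<Sum>j. \<integral>\<^sup>+y. ?g j y \<partial>\<mu>)" by (intro nn_integral_suminf) measurable
  also have "\<dots> = (\<Sum>j. ennreal (M * q ^ j) * (\<integral>\<^sup>+y. indicator (shell x (\<rho> j)) y / emeasure \<mu> (midball x y) \<partial>\<mu>))"
    by (intro suminf_cong nn_integral_cmult) measurable
  also have "\<dots> \<le> (\<Sum>j. ennreal (M * q ^ j) * ennreal D)"
    using nn_integral_shell_le \<rho> by (intro suminf_le mult_left_mono) auto
  also have "\<dots> = (\<Sum>j. ennreal (D * M * q ^ j))"
    using q D_pos by (intro suminf_cong) (simp add: ennreal_mult[symmetric] mult_ac)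
  also have "\<dots> = ennreal (D * M / (1 - q))"
    using q D_pos by (intro sum_geometric_ennreal) auto
  finally show ?thesis .
qed

text \<open>
  The counterpart for lower bounds.  Here the shells have to be disjoint, so that at most one term
  of the series is nonzero at each point.
\<close>

lemma nn_integral_dyadic_ge:
  assumes q: "0 \<le> q" "q < 1" "0 \<le> m" and \<rho>: "\<And>j. 0 < \<rho> j" and e: "norm e = 1"
    and disj: "disjoint_family (\<lambda>j. shell x (\<rho> j))"
    and ge: "\<And>j y. y \<in> shell x (\<rho> j) \<Longrightarrow> y \<in> cone x e \<Longrightarrow> ennreal (m * q ^ j) \<le> \<Phi> y"
  shows "ennreal (m / (D * (1 - q))) \<le> (\<integral>\<^sup>+y. \<Phi> y / emeasure \<mu> (midball x y) \<partial>\<mu>)"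
proof -
  let ?S = "\<lambda>j. shell x (\<rho> j) \<inter> cone x e"
  let ?g = "\<lambda>j y. ennreal (m * q ^ j) * (indicator (?S j) y / emeasure \<mu> (midball x y))"
  have "ennreal (m / (D * (1 - q))) = (\<Sum>j. ennreal ((m / D) * q ^ j))"
    using q D_pos by (subst sum_geometric_ennreal) auto
  also have "\<dots> = (\<Sum>j. ennreal (m * q ^ j) * (1 / ennreal D))"
    using q D_pos by (intro suminf_cong)
      (simp add: ennreal_mult[symmetric] divide_ennreal flip: ennreal_1)
  also have "\<dots> \<le> (\<Sum>j. ennreal (m * q ^ j) * (\<integral>\<^sup>+y. indicator (?S j) y / emeasure \<mu> (midball x y) \<partial>\<mu>))"
    using nn_integral_shell_cone_ge \<rho> e by (intro suminf_le mult_left_mono) auto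
  also have "\<dots> = (\<Sum>j. \<integral>\<^sup>+y. ?g j y \<partial>\<mu>)"
    by (intro suminf_cong nn_integral_cmult[symmetric]) measurable
  also have "\<dots> = (\<integral>\<^sup>+y. (\<Sum>j. ?g j y) \<partial>\<mu>)" by (intro nn_integral_suminf[symmetric]) measurable
  also have "\<dots> \<le> (\<integral>\<^sup>+y. \<Phi> y / emeasure \<mu> (midball x y) \<partial>\<mu>)"
  proof (intro nn_integral_mono)
    fix y
    show "(\<Sum>j. ?g j y) \<le> \<Phi> y / emeasure \<mu> (midball x y)"
    proof (cases "\<exists>j. y \<in> ?S j")
      case True
      then obtain j where j: "y \<in> shell x (\<rho> j)" "y \<in> cone x e" by auto
      have "y \<notin> shell x (\<rho> i)" if "i \<noteq> j" for i
        using disj that j by (auto simp: disjoint_family_on_def)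
      then have "(\<Sum>j. ?g j y) = (\<Sum>i\<in>{j}. ?g i y)"
        by (intro suminf_finite) auto
      also have "\<dots> \<le> \<Phi> y / emeasure \<mu> (midball x y)"
        using ge[OF j] j by (simp add: divide_ennreal_def mult_right_mono)
      finally show ?thesis .
    next
      case False
      then have "indicator (?S j) y = (0::ennreal)" for j by auto
      then show ?thesis by simp
    qed
  qed
  finally show ?thesis .
qed

text \<open>
  The shells \<open>R * 2 ^ j \<le> dist x y < R * 2 ^ Suc j\<close> cover the complement of the ball of radius \<open>R\<close>.
\<close>

lemma nn_integral_far_le:
  assumes R: "0 < R" and t: "0 < t"
  shows "(\<integral>\<^sup>+y. ennreal (if R \<le> dist x y then dist x y powr (- t) else 0) / emeasure \<mu> (midball x y) \<partial>\<mu>)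
     \<le> ennreal (D * R powr (- t) / (1 - 2 powr (- t)))"
proof (rule nn_integral_dyadic_le[where \<rho> = "\<lambda>j. R * 2 ^ j / 4"])
  show "2 powr (- t) < (1::real)" using powr_less_mono[of "- t" 0 2] t by simp
  fix y assume "ennreal (if R \<le> dist x y then dist x y powr (- t) else 0) \<noteq> 0"
  then have d: "R \<le> dist x y" by (auto split: if_splits)
  obtain j where j: "dist x y < R * 2 ^ Suc j" "\<And>i. i < j \<Longrightarrow> R * 2 ^ Suc i \<le> dist x y"
  proof -
    have "(1::real) < 2" by simp
    from real_arch_pow[OF this, of "dist x y / R"] obtain n where "dist x y / R < 2 ^ n" by blast
    then have "dist x y < R * 2 ^ n" using R by (simp add: pos_divide_less_eq mult.commute)
    also have "\<dots> \<le> R * 2 ^ Suc n" using R by simp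
    finally have "\<exists>j. dist x y < R * 2 ^ Suc j" by blast
    then have "\<exists>j. dist x y < R * 2 ^ Suc j \<and> (\<forall>i<j. \<not> dist x y < R * 2 ^ Suc i)"
      by (rule exists_least_iff[THEN iffD1])
    then obtain j where "dist x y < R * 2 ^ Suc j" "\<And>i. i < j \<Longrightarrow> \<not> dist x y < R * 2 ^ Suc i"
      by blast
    then show ?thesis using that by (meson not_less)
  qed
  have lo: "R * 2 ^ j \<le> dist x y"
    using d j(2)[of "j - 1"] by (cases j) auto
  have "dist x y powr (- t) \<le> (R * 2 ^ j) powr (- t)"
    using lo R t by (intro powr_mono2') auto
  then have "dist x y powr (- t) \<le> R powr (- t) * (2 powr (- t)) ^ j"
    by (simp only: powr_dyadic_up[OF R])
  then show "\<exists>j. y \<in> shell x (R * 2 ^ j / 4) \<and>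
      ennreal (if R \<le> dist x y then dist x y powr (- t) else 0) \<le> ennreal (R powr (- t) * (2 powr (- t)) ^ j)"
    using lo j(1) d by (intro exI[of _ j]) (auto simp: shell_def intro!: ennreal_leI)
qed (use R in auto)

text \<open>
  The shells \<open>R / 2 ^ Suc j \<le> dist x y < R / 2 ^ j\<close> cover the punctured ball of radius \<open>R\<close>; at the
  centre the integrand vanishes.
\<close>

lemma nn_integral_near_le:
  assumes R: "0 < R" and t: "0 < t"
  shows "(\<integral>\<^sup>+y. ennreal (if dist x y < R then dist x y powr t else 0) / emeasure \<mu> (midball x y) \<partial>\<mu>)
     \<le> ennreal (D * R powr t / (1 - 2 powr (- t)))"
proof (rule nn_integral_dyadic_le[where \<rho> = "\<lambda>j. R / 2 ^ Suc j / 4"])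
  show "2 powr (- t) < (1::real)" using powr_less_mono[of "- t" 0 2] t by simp
  fix y assume "ennreal (if dist x y < R then dist x y powr t else 0) \<noteq> 0"
  then have d: "dist x y < R" "0 < dist x y" by (auto split: if_splits)
  obtain j where j: "R / 2 ^ Suc j \<le> dist x y" "\<And>i. i < j \<Longrightarrow> dist x y < R / 2 ^ Suc i"
  proof -
    have "(1::real) < 2" by simp
    from real_arch_pow[OF this, of "R / dist x y"] obtain n where "R / dist x y < 2 ^ n" by blast
    then have "R < dist x y * 2 ^ n" using d by (simp add: pos_divide_less_eq mult.commute)
    then have "R / 2 ^ n \<le> dist x y" by (simp add: pos_divide_le_eq)
    moreover have "R / 2 ^ Suc n \<le> R / 2 ^ n" using R by (simp add: field_simps)
    ultimately have "R / 2 ^ Suc n \<le> dist x y" by linarith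
    then have "\<exists>j. R / 2 ^ Suc j \<le> dist x y" by blast
    then have "\<exists>j. R / 2 ^ Suc j \<le> dist x y \<and> (\<forall>i<j. \<not> R / 2 ^ Suc i \<le> dist x y)"
      by (rule exists_least_iff[THEN iffD1])
    then obtain j where "R / 2 ^ Suc j \<le> dist x y" "\<And>i. i < j \<Longrightarrow> \<not> R / 2 ^ Suc i \<le> dist x y"
      by blast
    then show ?thesis using that by (meson not_le)
  qed
  have hi: "dist x y < R / 2 ^ j"
    using d j(2)[of "j - 1"] by (cases j) auto
  have "dist x y powr t \<le> (R / 2 ^ j) powr t"
    using hi d t by (intro powr_mono2) auto
  also have "\<dots> = R powr t * (2 powr (- t)) ^ j"
    using R by (simp only: powr_dyadic_down)
  finally have "dist x y powr t \<le> R powr t * (2 powr (- t)) ^ j" .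
  then show "\<exists>j. y \<in> shell x (R / 2 ^ Suc j / 4) \<and>
      ennreal (if dist x y < R then dist x y powr t else 0) \<le> ennreal (R powr t * (2 powr (- t)) ^ j)"
    using hi j(1) d by (intro exI[of _ j]) (auto simp: shell_def intro!: ennreal_leI)
qed (use R in auto)

text \<open>
  The cone around any fixed axis already carries a fixed fraction of the mass of each shell, so the shell
  estimate for cones is applied with a coordinate axis.
\<close>

lemma nn_integral_far_ge:
  assumes R: "0 < R" and t: "0 < t"
  shows "ennreal ((2 * R) powr (- t) / (D * (1 - 2 powr (- t)))) \<le>
    (\<integral>\<^sup>+y. ennreal (if R \<le> dist x y then dist x y powr (- t) else 0) / emeasure \<mu> (midball x y) \<partial>\<mu>)"
proof (rule nn_integral_dyadic_ge[where \<rho> = "\<lambda>j. R * 2 ^ j / 4" and e = "axis undefined 1"])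
  show "2 powr (- t) < (1::real)" using powr_less_mono[of "- t" 0 2] t by simp
  \<comment> \<open>the shell with parameter \<open>r\<close> begins at radius \<open>4 * r\<close>, hence the factor 1/4 in \<open>\<rho>\<close>\<close>
  show "disjoint_family (\<lambda>j. shell x (R * 2 ^ j / 4))"
  proof (rule disjoint_shells)
    fix i j :: nat assume "i < j"
    then have "(2::real) ^ Suc i \<le> 2 ^ j" by (intro power_increasing) auto
    then show "2 * (R * 2 ^ i / 4) \<le> R * 2 ^ j / 4 \<or> 2 * (R * 2 ^ j / 4) \<le> R * 2 ^ i / 4" using R by simp
  qed
  fix j y assume "y \<in> shell x (R * 2 ^ j / 4)"
  then have d: "R * 2 ^ j \<le> dist x y" "dist x y < 2 * R * 2 ^ j" by (auto simp: shell_def)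
  have "R * 1 \<le> R * 2 ^ j" using R by (intro mult_left_mono) auto
  then have d2: "R \<le> dist x y" using d by simp
  have "(2 * R) powr (- t) * (2 powr (- t)) ^ j = (2 * R * 2 ^ j) powr (- t)"
    using R by (subst powr_dyadic_up) auto
  also have "\<dots> \<le> dist x y powr (- t)"
    using d d2 R t by (intro powr_mono2') auto
  finally show "ennreal ((2 * R) powr (- t) * (2 powr (- t)) ^ j)
      \<le> ennreal (if R \<le> dist x y then dist x y powr (- t) else 0)"
    using d2 by (auto intro!: ennreal_leI)
qed (use R in auto)

lemma nn_integral_near_cone_ge:
  assumes R: "0 < R" and t: "0 < t" and e: "norm e = 1"
  shows "ennreal ((R / 2) powr t / (D * (1 - 2 powr (- t)))) \<le>
    (\<integral>\<^sup>+y. ennreal (if dist x y < R \<and> y \<in> cone x e then dist x y powr t else 0) / emeasure \<mu> (midball x y) \<partial>\<mu>)"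
proof (rule nn_integral_dyadic_ge[where \<rho> = "\<lambda>j. R / 2 ^ Suc j / 4", OF _ _ _ _ e])
  show "2 powr (- t) < (1::real)" using powr_less_mono[of "- t" 0 2] t by simp
  show "disjoint_family (\<lambda>j. shell x (R / 2 ^ Suc j / 4))"
  proof (rule disjoint_shells)
    fix i j :: nat assume "i < j"
    then have "(2::real) ^ Suc i \<le> 2 ^ j" by (intro power_increasing) auto
    then have "R / 2 ^ j \<le> R / 2 ^ Suc i" using R by (intro divide_left_mono) auto
    then show "2 * (R / 2 ^ Suc i / 4) \<le> R / 2 ^ Suc j / 4 \<or> 2 * (R / 2 ^ Suc j / 4) \<le> R / 2 ^ Suc i / 4" by simp
  qed
  fix j y assume "y \<in> shell x (R / 2 ^ Suc j / 4)" and c: "y \<in> cone x e"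
  then have d: "R / 2 / 2 ^ j \<le> dist x y" "dist x y < R / 2 ^ j" by (auto simp: shell_def)
  have "R / 2 ^ j \<le> R / 1" using R by (intro divide_left_mono) auto
  then have d2: "y \<in> ball x R" using d by simp
  have "(R / 2) powr t * (2 powr (- t)) ^ j = (R / 2 / 2 ^ j) powr t"
    using R by (subst powr_dyadic_down) auto
  also have "\<dots> \<le> dist x y powr t"
    using d R t by (intro powr_mono2) auto
  finally show "ennreal ((R / 2) powr t * (2 powr (- t)) ^ j)
      \<le> ennreal (if dist x y < R \<and> y \<in> cone x e then dist x y powr t else 0)"
    using d2 c by (auto intro!: ennreal_leI)
qed (use R in auto)

end

section \<open>The energy of a doubling measure\<close>

context doubling_measure
begin

text \<open>
  The energy without its factor \<open>s * (1 - s)\<close>, for the kernel \<open>1 / \<mu>(B_{x,y})\<close> with respect to the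
  product of \<open>\<mu>\<close> with itself.
\<close>

definition energy\<mu> :: "real \<Rightarrow> (real^'n \<Rightarrow> real) \<Rightarrow> real \<Rightarrow> ennreal" where
  "energy\<mu> p v s = (\<integral>\<^sup>+x. (\<integral>\<^sup>+y. ennreal ((\<bar>v x - v y\<bar> / norm (x - y) powr s) powr p)
      / emeasure \<mu> (midball x y) \<partial>\<mu>) \<partial>\<mu>)"

text \<open>
  Distant pairs are estimated by \<open>2 powr p * (\<bar>v x\<bar> powr p + \<bar>v y\<bar> powr p)\<close>.  By the symmetry of the
  kernel and Tonelli's theorem, both summands contribute the same amount, hence the factor \<open>2\<close>.
  Close pairs are estimated by the local Lipschitz bound \<open>h\<close>.
\<close>

lemma energy_le_far_plus_near:
  fixes v h :: "real^'n \<Rightarrow> real"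
  assumes [measurable]: "v \<in> borel_measurable borel" "h \<in> borel_measurable borel"
    and h: "\<And>x. 0 \<le> h x" and \<delta>: "0 < \<delta>" and p: "0 < p" and s: "0 < s" "s < 1"
    and near: "\<And>x y. dist x y < \<delta> \<Longrightarrow> \<bar>v x - v y\<bar> \<le> h x * dist x y"
  shows "energy\<mu> p v s \<le>
     ennreal (2 * (2 powr p * (D * \<delta> powr (- (s * p)) / (1 - 2 powr (- (s * p)))))) * (\<integral>\<^sup>+x. ennreal (\<bar>v x\<bar> powr p) \<partial>\<mu>)
   + ennreal (D * \<delta> powr ((1 - s) * p) / (1 - 2 powr (- ((1 - s) * p)))) * (\<integral>\<^sup>+x. ennreal (h x powr p) \<partial>\<mu>)"
proof -
  define F where "F x y = ennreal (if \<delta> \<le> dist x y then dist x y powr (- (s * p)) else 0)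
      / emeasure \<mu> (midball x y)" for x y
  define N where "N x y = ennreal (if dist x y < \<delta> then dist x y powr ((1 - s) * p) else 0)
      / emeasure \<mu> (midball x y)" for x y
  have [measurable]: "fst \<in> borel_measurable (\<mu> \<Otimes>\<^sub>M \<mu>)" "snd \<in> borel_measurable (\<mu> \<Otimes>\<^sub>M \<mu>)"
    by (subst measurable_cong_sets[OF refl sets_eq_borel[symmetric]], simp)+
  have [measurable]: "(\<lambda>z. dist (fst z) (snd z)) \<in> borel_measurable (\<mu> \<Otimes>\<^sub>M \<mu>)" by measurable
  have [measurable]: "v \<in> borel_measurable \<mu>" "h \<in> borel_measurable \<mu>" by measurable
  have Fm: "(\<lambda>z. F (fst z) (snd z)) \<in> borel_measurable (\<mu> \<Otimes>\<^sub>M \<mu>)" unfolding F_def by measurable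
  have Nm: "(\<lambda>z. N (fst z) (snd z)) \<in> borel_measurable (\<mu> \<Otimes>\<^sub>M \<mu>)" unfolding N_def by measurable
  have [measurable]: "(\<lambda>y. F x y) \<in> borel_measurable \<mu>" "(\<lambda>y. N x y) \<in> borel_measurable \<mu>"  for x
    unfolding F_def N_def by measurable
  have Fs: "F x y = F y x" for x y by (simp add: F_def dist_commute midball_commute)
  have sp: "0 < s * p" "0 < (1 - s) * p" using s p by auto
  let ?cF = "D * \<delta> powr (- (s * p)) / (1 - 2 powr (- (s * p)))"
  let ?cN = "D * \<delta> powr ((1 - s) * p) / (1 - 2 powr (- ((1 - s) * p)))"
  have IF: "(\<integral>\<^sup>+y. F x y \<partial>\<mu>) \<le> ennreal ?cF" for x
    unfolding F_def by (rule nn_integral_far_le[OF \<delta> sp(1)])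
  have IN: "(\<integral>\<^sup>+y. N x y \<partial>\<mu>) \<le> ennreal ?cN" for x
    unfolding N_def by (rule nn_integral_near_le[OF \<delta> sp(2)])
  let ?V = "\<lambda>x. ennreal (2 powr p * \<bar>v x\<bar> powr p)" and ?H = "\<lambda>x. ennreal (h x powr p)"
  have pt: "ennreal ((\<bar>v x - v y\<bar> / norm (x - y) powr s) powr p) / emeasure \<mu> (midball x y)
    \<le> ?V x * F x y + ?V y * F x y + ?H x * N x y" for x y
  proof (cases "\<delta> \<le> dist x y")
    case True
    have "\<bar>v x - v y\<bar> powr p \<le> (\<bar>v x\<bar> + \<bar>v y\<bar>) powr p"
      using p by (intro powr_mono2) auto
    also have "\<dots> \<le> 2 powr p * (\<bar>v x\<bar> powr p + \<bar>v y\<bar> powr p)"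
      using p by (intro powr_add_le) auto
    finally have "(\<bar>v x - v y\<bar> / norm (x - y) powr s) powr p
        \<le> (2 powr p * \<bar>v x\<bar> powr p + 2 powr p * \<bar>v y\<bar> powr p) * dist x y powr (- (s * p))"
      unfolding quotient_powr by (intro mult_right_mono) (auto simp: algebra_simps)
    then have "ennreal ((\<bar>v x - v y\<bar> / norm (x - y) powr s) powr p)
        \<le> (?V x + ?V y) * ennreal (dist x y powr (- (s * p)))"
      by (subst ennreal_plus[symmetric], simp, simp, subst ennreal_mult[symmetric]) (auto intro!: ennreal_leI)
    then have "ennreal ((\<bar>v x - v y\<bar> / norm (x - y) powr s) powr p) / emeasure \<mu> (midball x y)
        \<le> (?V x + ?V y) * ennreal (dist x y powr (- (s * p))) / emeasure \<mu> (midball x y)"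
      by (rule divide_right_mono_ennreal)
    also have "\<dots> = ?V x * F x y + ?V y * F x y"
      using True by (simp add: F_def ring_distribs divide_ennreal_def mult.assoc)
    also have "\<dots> \<le> ?V x * F x y + ?V y * F x y + ?H x * N x y" by (rule add_increasing2) auto
    finally show ?thesis .
  next
    case False
    have "\<bar>v x - v y\<bar> powr p \<le> (h x * dist x y) powr p"
      using False near p by (intro powr_mono2) auto
    also have "\<dots> = h x powr p * dist x y powr p" using h by (simp add: powr_mult)
    finally have "(\<bar>v x - v y\<bar> / norm (x - y) powr s) powr p
        \<le> h x powr p * dist x y powr p * dist x y powr (- (s * p))"
      unfolding quotient_powr by (intro mult_right_mono) auto
    also have "\<dots> = h x powr p * dist x y powr ((1 - s) * p)"
      by (simp add: powr_add[symmetric] algebra_simps)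
    finally have "ennreal ((\<bar>v x - v y\<bar> / norm (x - y) powr s) powr p)
        \<le> ?H x * ennreal (dist x y powr ((1 - s) * p))"
      by (subst ennreal_mult[symmetric]) (auto intro!: ennreal_leI)
    then have "ennreal ((\<bar>v x - v y\<bar> / norm (x - y) powr s) powr p) / emeasure \<mu> (midball x y)
        \<le> ?H x * ennreal (dist x y powr ((1 - s) * p)) / emeasure \<mu> (midball x y)"
      by (rule divide_right_mono_ennreal)
    also have "\<dots> = ?H x * N x y"
      using False by (simp add: N_def divide_ennreal_def mult.assoc)
    also have "\<dots> \<le> ?V x * F x y + ?V y * F x y + ?H x * N x y" by (rule add_increasing) auto
    finally show ?thesis .
  qed
  have m1: "(\<lambda>z. ?V (fst z) * F (fst z) (snd z)) \<in> borel_measurable (\<mu> \<Otimes>\<^sub>M \<mu>)"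
    and m2: "(\<lambda>z. ?V (snd z) * F (fst z) (snd z)) \<in> borel_measurable (\<mu> \<Otimes>\<^sub>M \<mu>)"
    and m3: "(\<lambda>z. ?H (fst z) * N (fst z) (snd z)) \<in> borel_measurable (\<mu> \<Otimes>\<^sub>M \<mu>)"
    using Fm Nm by measurable
  note mm = m1[THEN borel_measurable_nn_integral_fst, unfolded fst_conv snd_conv]
    m2[THEN borel_measurable_nn_integral_fst, unfolded fst_conv snd_conv]
    m3[THEN borel_measurable_nn_integral_fst, unfolded fst_conv snd_conv]
  have twice: "ennreal (2 * a) * X = ennreal a * X + ennreal a * X" for a :: real and X
  proof -
    have "ennreal (2 * a) = ennreal 2 * ennreal a" by (rule ennreal_mult') simp
    also have "ennreal 2 = 2" by (rule ennreal_numeral)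
    finally show ?thesis by (simp only: mult_2 distrib_right)
  qed
  have A: "(\<integral>\<^sup>+x. (\<integral>\<^sup>+y. ?V x * F x y \<partial>\<mu>) \<partial>\<mu>) \<le> ennreal (2 powr p * ?cF) * (\<integral>\<^sup>+x. ennreal (\<bar>v x\<bar> powr p) \<partial>\<mu>)"
  proof -
    have "(\<integral>\<^sup>+x. (\<integral>\<^sup>+y. ?V x * F x y \<partial>\<mu>) \<partial>\<mu>) = (\<integral>\<^sup>+x. ?V x * (\<integral>\<^sup>+y. F x y \<partial>\<mu>) \<partial>\<mu>)"
      by (intro nn_integral_cong nn_integral_cmult) measurable
    also have "\<dots> \<le> (\<integral>\<^sup>+x. ?V x * ennreal ?cF \<partial>\<mu>)"
      using IF by (intro nn_integral_mono mult_left_mono) auto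
    also have "\<dots> = (\<integral>\<^sup>+x. ennreal (2 powr p * ?cF) * ennreal (\<bar>v x\<bar> powr p) \<partial>\<mu>)"
      unfolding ennreal_mult'[of "2 powr p" "?cF", OF powr_ge_zero]
        ennreal_mult'[of "2 powr p" "\<bar>v x\<bar> powr p" for x, OF powr_ge_zero]
      by (simp only: mult.assoc mult.commute mult.left_commute)
    also have "\<dots> = ennreal (2 powr p * ?cF) * (\<integral>\<^sup>+x. ennreal (\<bar>v x\<bar> powr p) \<partial>\<mu>)"
      by (intro nn_integral_cmult) measurable
    finally show ?thesis .
  qed
  have B: "(\<integral>\<^sup>+x. (\<integral>\<^sup>+y. ?V y * F x y \<partial>\<mu>) \<partial>\<mu>) = (\<integral>\<^sup>+x. (\<integral>\<^sup>+y. ?V x * F x y \<partial>\<mu>) \<partial>\<mu>)"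
  proof -
    have "(\<integral>\<^sup>+x. (\<integral>\<^sup>+y. ?V y * F x y \<partial>\<mu>) \<partial>\<mu>) = (\<integral>\<^sup>+y. (\<integral>\<^sup>+x. ?V y * F x y \<partial>\<mu>) \<partial>\<mu>)"
      by (rule pair.Fubini'[symmetric]) (use m2 in \<open>simp only: split_beta'\<close>)
    also have "\<dots> = (\<integral>\<^sup>+y. (\<integral>\<^sup>+x. ?V y * F y x \<partial>\<mu>) \<partial>\<mu>)"
      by (intro nn_integral_cong) (subst Fs, rule refl)
    finally show ?thesis .
  qed
  have C: "(\<integral>\<^sup>+x. (\<integral>\<^sup>+y. ?H x * N x y \<partial>\<mu>) \<partial>\<mu>) \<le> ennreal ?cN * (\<integral>\<^sup>+x. ennreal (h x powr p) \<partial>\<mu>)"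
  proof -
    have "(\<integral>\<^sup>+x. (\<integral>\<^sup>+y. ?H x * N x y \<partial>\<mu>) \<partial>\<mu>) = (\<integral>\<^sup>+x. ?H x * (\<integral>\<^sup>+y. N x y \<partial>\<mu>) \<partial>\<mu>)"
      by (intro nn_integral_cong nn_integral_cmult) measurable
    also have "\<dots> \<le> (\<integral>\<^sup>+x. ennreal ?cN * ?H x \<partial>\<mu>)"
      unfolding mult.commute[of "ennreal ?cN"] using IN by (intro nn_integral_mono mult_left_mono) auto
    also have "\<dots> = ennreal ?cN * (\<integral>\<^sup>+x. ennreal (h x powr p) \<partial>\<mu>)"
      by (intro nn_integral_cmult) measurable
    finally show ?thesis .
  qed
  have "energy\<mu> p v s \<le> (\<integral>\<^sup>+x. (\<integral>\<^sup>+y. ?V x * F x y + ?V y * F x y + ?H x * N x y \<partial>\<mu>) \<partial>\<mu>)"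
    unfolding energy\<mu>_def by (intro nn_integral_mono pt)
  also have "\<dots> = (\<integral>\<^sup>+x. (\<integral>\<^sup>+y. ?V x * F x y \<partial>\<mu>) + (\<integral>\<^sup>+y. ?V y * F x y \<partial>\<mu>) + (\<integral>\<^sup>+y. ?H x * N x y \<partial>\<mu>) \<partial>\<mu>)"
  proof (intro nn_integral_cong)
    fix x
    have "(\<lambda>y. ?V x * F x y) \<in> borel_measurable \<mu>" "(\<lambda>y. ?V y * F x y) \<in> borel_measurable \<mu>"
      "(\<lambda>y. ?H x * N x y) \<in> borel_measurable \<mu>" by measurable
    then show "(\<integral>\<^sup>+y. ?V x * F x y + ?V y * F x y + ?H x * N x y \<partial>\<mu>) =
      (\<integral>\<^sup>+y. ?V x * F x y \<partial>\<mu>) + (\<integral>\<^sup>+y. ?V y * F x y \<partial>\<mu>) + (\<integral>\<^sup>+y. ?H x * N x y \<partial>\<mu>)"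
      by (simp only: nn_integral_add borel_measurable_add)
  qed
  also have "\<dots> = (\<integral>\<^sup>+x. (\<integral>\<^sup>+y. ?V x * F x y \<partial>\<mu>) \<partial>\<mu>) + (\<integral>\<^sup>+x. (\<integral>\<^sup>+y. ?V y * F x y \<partial>\<mu>) \<partial>\<mu>) + (\<integral>\<^sup>+x. (\<integral>\<^sup>+y. ?H x * N x y \<partial>\<mu>) \<partial>\<mu>)"
    by (simp only: nn_integral_add borel_measurable_add mm)
  also have "\<dots> \<le> ennreal (2 powr p * ?cF) * (\<integral>\<^sup>+x. ennreal (\<bar>v x\<bar> powr p) \<partial>\<mu>)
     + ennreal (2 powr p * ?cF) * (\<integral>\<^sup>+x. ennreal (\<bar>v x\<bar> powr p) \<partial>\<mu>)
     + ennreal ?cN * (\<integral>\<^sup>+x. ennreal (h x powr p) \<partial>\<mu>)"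
    by (rule add_mono[OF add_mono[OF A A[folded B]] C])
  also have "\<dots> = ennreal (2 * (2 powr p * ?cF)) * (\<integral>\<^sup>+x. ennreal (\<bar>v x\<bar> powr p) \<partial>\<mu>)
     + ennreal ?cN * (\<integral>\<^sup>+x. ennreal (h x powr p) \<partial>\<mu>)"
    by (simp only: twice)
  finally show ?thesis .
qed

text \<open>
  Since the support lies in the ball of radius \<open>R / 2\<close>, if \<open>x\<close> is in the support of \<open>v\<close> and \<open>y\<close> is at distance at least \<open>R\<close> from \<open>x\<close>, then \<open>y\<close> is outside
  the support, so \<open>v x - v y\<close> is just \<open>v x\<close>.
\<close>

lemma energy_ge_far:
  fixes v :: "real^'n \<Rightarrow> real"
  assumes [measurable]: "v \<in> borel_measurable borel"
    and R: "0 < R" and p: "0 < p" and s: "0 < s"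
    and supp: "\<And>x. v x \<noteq> 0 \<Longrightarrow> norm x < R / 2"
  shows "ennreal ((2 * R) powr (- (s * p)) / (D * (1 - 2 powr (- (s * p))))) * (\<integral>\<^sup>+x. ennreal (\<bar>v x\<bar> powr p) \<partial>\<mu>)
     \<le> energy\<mu> p v s"
proof -
  have sp: "0 < s * p" using s p by auto
  let ?F = "\<lambda>x y. ennreal (if R \<le> dist x y then dist x y powr (- (s * p)) else 0)
      / emeasure \<mu> (midball x y)"
  let ?c = "(2 * R) powr (- (s * p)) / (D * (1 - 2 powr (- (s * p))))"
  have [measurable]: "v \<in> borel_measurable \<mu>" by measurable
  have "ennreal ?c * (\<integral>\<^sup>+x. ennreal (\<bar>v x\<bar> powr p) \<partial>\<mu>) = (\<integral>\<^sup>+x. ennreal ?c * ennreal (\<bar>v x\<bar> powr p) \<partial>\<mu>)"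
    by (intro nn_integral_cmult[symmetric]) measurable
  also have "\<dots> \<le> (\<integral>\<^sup>+x. (\<integral>\<^sup>+y. ?F x y \<partial>\<mu>) * ennreal (\<bar>v x\<bar> powr p) \<partial>\<mu>)"
    by (intro nn_integral_mono mult_right_mono nn_integral_far_ge[OF R sp]) auto
  also have "\<dots> = (\<integral>\<^sup>+x. (\<integral>\<^sup>+y. ?F x y * ennreal (\<bar>v x\<bar> powr p) \<partial>\<mu>) \<partial>\<mu>)"
    by (intro nn_integral_cong nn_integral_multc[symmetric]) measurable
  also have "\<dots> \<le> energy\<mu> p v s"
    unfolding energy\<mu>_def
  proof (intro nn_integral_mono)
    fix x y
    show "?F x y * ennreal (\<bar>v x\<bar> powr p)
      \<le> ennreal ((\<bar>v x - v y\<bar> / norm (x - y) powr s) powr p) / emeasure \<mu> (midball x y)"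
    proof (cases "R \<le> dist x y \<and> v x \<noteq> 0")
      case True
      have "v y = 0"
      proof (rule ccontr)
        assume "v y \<noteq> 0"
        then have "norm x < R / 2" "norm y < R / 2" using True supp by auto
        then show False using True norm_triangle_ineq4[of x y] by (simp add: dist_norm)
      qed
      then show ?thesis using True unfolding quotient_powr
        by (simp add: ennreal_mult' divide_ennreal_def mult_ac)
    qed auto
  qed
  finally show ?thesis .
qed

text \<open>
  A pointwise lower bound for the difference quotient on a cone suffices, and the axis may turn with \<open>x\<close>:
  the lower bound for the integral over the cone is the same for all axes.
\<close>

lemma energy_ge_near:
  fixes v h :: "real^'n \<Rightarrow> real"
  assumes [measurable]: "h \<in> borel_measurable borel"
    and h: "\<And>x. 0 \<le> h x" and \<delta>: "0 < \<delta>" and p: "0 < p" and s: "s < 1"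
    and e: "\<And>x. norm (e x) = 1"
    and near: "\<And>x y. dist x y < \<delta> \<Longrightarrow> y \<in> cone x (e x) \<Longrightarrow> h x * dist x y \<le> \<bar>v x - v y\<bar>"
  shows "ennreal ((\<delta> / 2) powr ((1 - s) * p) / (D * (1 - 2 powr (- ((1 - s) * p))))) * (\<integral>\<^sup>+x. ennreal (h x powr p) \<partial>\<mu>)
     \<le> energy\<mu> p v s"
proof -
  have sp: "0 < (1 - s) * p" using s p by auto
  let ?F = "\<lambda>x y. ennreal (if dist x y < \<delta> \<and> y \<in> cone x (e x) then dist x y powr ((1 - s) * p) else 0)
      / emeasure \<mu> (midball x y)"
  let ?c = "(\<delta> / 2) powr ((1 - s) * p) / (D * (1 - 2 powr (- ((1 - s) * p))))"
  have [measurable]: "h \<in> borel_measurable \<mu>" by measurable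
  have "ennreal ?c * (\<integral>\<^sup>+x. ennreal (h x powr p) \<partial>\<mu>) = (\<integral>\<^sup>+x. ennreal ?c * ennreal (h x powr p) \<partial>\<mu>)"
    by (intro nn_integral_cmult[symmetric]) measurable
  also have "\<dots> \<le> (\<integral>\<^sup>+x. (\<integral>\<^sup>+y. ?F x y \<partial>\<mu>) * ennreal (h x powr p) \<partial>\<mu>)"
    by (intro nn_integral_mono mult_right_mono nn_integral_near_cone_ge[OF \<delta> sp e]) auto
  also have "\<dots> = (\<integral>\<^sup>+x. (\<integral>\<^sup>+y. ?F x y * ennreal (h x powr p) \<partial>\<mu>) \<partial>\<mu>)"
    by (intro nn_integral_cong nn_integral_multc[symmetric]) measurable
  also have "\<dots> \<le> energy\<mu> p v s"
    unfolding energy\<mu>_def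
  proof (intro nn_integral_mono)
    fix x y
    show "?F x y * ennreal (h x powr p)
      \<le> ennreal ((\<bar>v x - v y\<bar> / norm (x - y) powr s) powr p) / emeasure \<mu> (midball x y)"
    proof (cases "dist x y < \<delta> \<and> y \<in> cone x (e x)")
      case True
      have "h x powr p * dist x y powr ((1 - s) * p) = (h x * dist x y) powr p * dist x y powr (- (s * p))"
        using h by (simp add: powr_mult powr_add[symmetric] algebra_simps)
      also have "\<dots> \<le> \<bar>v x - v y\<bar> powr p * dist x y powr (- (s * p))"
        using True near h p by (intro mult_right_mono powr_mono2) auto
      finally have "ennreal (dist x y powr ((1 - s) * p) * h x powr p)
         \<le> ennreal ((\<bar>v x - v y\<bar> / norm (x - y) powr s) powr p)"
        unfolding quotient_powr by (intro ennreal_leI) (simp add: mult.commute)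
      then have "ennreal (dist x y powr ((1 - s) * p) * h x powr p) / emeasure \<mu> (midball x y)
         \<le> ennreal ((\<bar>v x - v y\<bar> / norm (x - y) powr s) powr p) / emeasure \<mu> (midball x y)"
        by (rule divide_right_mono_ennreal)
      then show ?thesis using True
        by (simp add: ennreal_mult' divide_ennreal_def mult_ac)
    qed auto
  qed
  finally show ?thesis .
qed

end

section \<open>Test functions\<close>

lemma Cc_infty_has_derivative:
  assumes "v \<in> Cc_infty"
  shows "(v has_derivative (\<lambda>h. grad v x \<bullet> h)) (at x)"
proof -
  have "C_k 1 v" using assms by (auto simp: Cc_infty_def)
  then have "v differentiable (at x)" by simp
  then have D: "(v has_derivative frechet_derivative v (at x)) (at x)"
    by (simp add: frechet_derivative_works)
  then interpret bounded_linear "frechet_derivative v (at x)" by (rule has_derivative_bounded_linear)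
  have "frechet_derivative v (at x) h = grad v x \<bullet> h" for h
  proof -
    have "frechet_derivative v (at x) h = frechet_derivative v (at x) (\<Sum>i\<in>UNIV. (h $ i) *\<^sub>R axis i 1)"
      by (simp add: basis_expansion flip: scalar_mult_eq_scaleR)
    also have "\<dots> = grad v x \<bullet> h"
      by (simp add: sum scaleR inner_vec_def grad_def partial_def mult.commute)
    finally show ?thesis .
  qed
  then have "frechet_derivative v (at x) = (\<lambda>h. grad v x \<bullet> h)" by (rule ext)
  with D show ?thesis by simp
qed

lemma Cc_infty_continuous:
  assumes "v \<in> Cc_infty"
  shows "continuous_on UNIV v" "continuous_on UNIV (grad v)"
proof -
  have "C_k 0 v" "C_k (Suc (Suc 0)) v" using assms unfolding Cc_infty_def by blast+
  then show "continuous_on UNIV v" by simp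
  have "partial i v differentiable (at x)" for i x
    using \<open>C_k (Suc (Suc 0)) v\<close> by simp
  then have "continuous_on UNIV (partial i v)" for i
    by (intro continuous_at_imp_continuous_on ballI differentiable_imp_continuous_within)
  then show "continuous_on UNIV (grad v)"
    unfolding grad_def by (intro continuous_on_vec_lambda) simp
qed

lemma Cc_infty_support:
  assumes "v \<in> Cc_infty"
  obtains R where "0 < R" "\<And>x. v x \<noteq> 0 \<Longrightarrow> norm x < R" "\<And>x. grad v x \<noteq> 0 \<Longrightarrow> norm x < R"
proof -
  let ?K = "closure {x. v x \<noteq> 0}"
  have "bounded ?K" using assms by (simp add: Cc_infty_def compact_imp_bounded)
  then obtain R where R: "0 < R" "?K \<subseteq> ball 0 R"
    by (metis bounded_subset_ballD)
  have "norm x < R" if "v x \<noteq> 0" for x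
    using that closure_subset[of "{x. v x \<noteq> 0}"] R by auto
  moreover have "norm x < R" if "grad v x \<noteq> 0" for x
  proof (rule ccontr)
    assume "\<not> norm x < R"
    then have x: "x \<in> - ?K" using R(2) by auto
    have "((\<lambda>x. 0) has_derivative (\<lambda>h. grad v x \<bullet> h)) (at x)"
    proof (rule has_derivative_transform_within_open[OF Cc_infty_has_derivative[OF assms] _ x])
      show "v y = 0" if "y \<in> - ?K" for y
        using that closure_subset[of "{x. v x \<noteq> 0}"] by auto
    qed (simp add: open_Compl)
    then have "(\<lambda>h. grad v x \<bullet> h) = (\<lambda>h. 0)"
      by (rule has_derivative_unique) (rule has_derivative_const)
    then have "grad v x \<bullet> grad v x = 0" by metis
    with that show False by simp
  qed
  ultimately show ?thesis using that R(1) by blast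
qed

text \<open>
  The gradient is uniformly continuous on a ball around the support, and the mean value inequality
  applies to \<open>v\<close> minus its linear part at \<open>x\<close>.  The bound \<open>\<delta> \<le> 1\<close> keeps \<open>x\<close> and \<open>y\<close> both outside the
  support once \<open>x\<close> is at distance \<open>1\<close> from a ball that contains it, so that the estimate is uniform on the whole space.
\<close>

lemma Cc_infty_uniform_linearization:
  assumes v: "v \<in> Cc_infty" and \<epsilon>: "0 < \<epsilon>"
  obtains \<delta> where "0 < \<delta>" "\<delta> \<le> 1"
    "\<And>x y. dist x y < \<delta> \<Longrightarrow> \<bar>v x - v y - grad v x \<bullet> (x - y)\<bar> \<le> \<epsilon> * dist x y"
proof -
  obtain R where R: "0 < R" "\<And>x. v x \<noteq> 0 \<Longrightarrow> norm x < R" "\<And>x. grad v x \<noteq> 0 \<Longrightarrow> norm x < R"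
    using Cc_infty_support[OF v] by metis
  have "uniformly_continuous_on (cball 0 (R + 2)) (grad v)"
    by (intro compact_uniformly_continuous compact_cball continuous_on_subset[OF Cc_infty_continuous(2)[OF v]]) auto
  then have "\<exists>d>0. \<forall>x\<in>cball 0 (R + 2). \<forall>y\<in>cball 0 (R + 2). dist y x < d \<longrightarrow> dist (grad v y) (grad v x) < \<epsilon>"
    using \<epsilon> unfolding uniformly_continuous_on_def by blast
  then obtain d where d0: "0 < d" "\<forall>x\<in>cball 0 (R + 2). \<forall>y\<in>cball 0 (R + 2). dist y x < d \<longrightarrow> dist (grad v y) (grad v x) < \<epsilon>"
    by (elim exE conjE)
  have d: "dist (grad v y) (grad v x) < \<epsilon>"
    if "x \<in> cball 0 (R + 2)" "y \<in> cball 0 (R + 2)" "dist y x < d" for x y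
    using bspec[OF bspec[OF d0(2) that(1)] that(2)] that(3) by (rule mp)
  \<comment> \<open>\<open>\<delta> \<le> 1\<close> ensures that \<open>y\<close> stays in the larger ball if \<open>norm x < R + 1\<close>, and outside the support otherwise\<close>
  let ?\<delta> = "min d 1"
  have "\<bar>v x - v y - grad v x \<bullet> (x - y)\<bar> \<le> \<epsilon> * dist x y" if xy: "dist x y < ?\<delta>" for x y
  proof (cases "norm x < R + 1")
    case True
    let ?f = "\<lambda>z. v z - grad v x \<bullet> z"
    have "norm (?f x - ?f y) \<le> \<epsilon> * norm (x - y)"
    proof (rule differentiable_bound[of "ball x ?\<delta>" ?f "\<lambda>z h. grad v z \<bullet> h - grad v x \<bullet> h"])
      fix z assume z: "z \<in> ball x ?\<delta>"
      show "(?f has_derivative (\<lambda>h. grad v z \<bullet> h - grad v x \<bullet> h)) (at z within ball x ?\<delta>)"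
        by (rule has_derivative_at_withinI) (intro has_derivative_diff Cc_infty_has_derivative[OF v]
            bounded_linear_imp_has_derivative bounded_linear_inner_right)
      have "norm z \<le> norm x + dist x z"
        using norm_triangle_sub[of z x] by (simp add: dist_norm norm_minus_commute)
      then have "dist (grad v z) (grad v x) < \<epsilon>"
        using z True by (intro d) (auto simp: dist_commute)
      then have g: "norm (grad v z - grad v x) \<le> \<epsilon>" by (simp add: dist_norm)
      have "\<bar>grad v z \<bullet> h - grad v x \<bullet> h\<bar> \<le> \<epsilon> * norm h" for h
      proof -
        have "\<bar>grad v z \<bullet> h - grad v x \<bullet> h\<bar> \<le> norm (grad v z - grad v x) * norm h"
          using Cauchy_Schwarz_ineq2[of "grad v z - grad v x" h] by (simp add: inner_diff_left)
        also have "\<dots> \<le> \<epsilon> * norm h" using g by (intro mult_right_mono) auto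
        finally show ?thesis .
      qed
      then show "onorm (\<lambda>h. grad v z \<bullet> h - grad v x \<bullet> h) \<le> \<epsilon>"
        using \<epsilon> by (intro onorm_bound) auto
    qed (use xy d0(1) in \<open>auto simp: dist_commute\<close>)
    then show ?thesis by (simp add: dist_norm inner_diff_right algebra_simps)
  next
    case False
    have "norm x \<le> norm y + dist x y"
      using norm_triangle_sub[of x y] by (simp add: dist_norm)
    then have "R \<le> norm y" "R \<le> norm x" using False xy by auto
    then have "v x = 0" "v y = 0" "grad v x = 0" using R by (meson not_less)+
    then show ?thesis using \<epsilon> by simp
  qed
  then show ?thesis using that[of ?\<delta>] d0(1) by auto
qed

text \<open>
  This gives the finiteness of the integrals of \<open>\<bar>v\<bar> powr p\<close> and \<open>norm (grad v) powr p\<close>.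
\<close>

lemma bounded_of_support:
  fixes f :: "real^'n \<Rightarrow> 'b::real_normed_vector"
  assumes "continuous_on UNIV f" "\<And>x. f x \<noteq> 0 \<Longrightarrow> norm x < R"
  obtains M where "\<And>x. norm (f x) \<le> M"
proof -
  have "compact (f ` cball 0 R)"
    using assms(1) by (intro compact_continuous_image) (auto intro: continuous_on_subset)
  then obtain M where M: "\<And>x. x \<in> cball 0 R \<Longrightarrow> norm (f x) \<le> M"
    by (meson bounded_iff compact_imp_bounded imageI)
  have "norm (f x) \<le> max M 0" for x
    using M[of x] assms(2)[of x] by (cases "f x = 0") auto
  then show ?thesis by (rule that)
qed

section \<open>The limits of the scaled energy\<close>

text \<open>
  The value of the geometric series \<open>\<Sum>j. (c * 2 powr - j) powr (t * p)\<close>.  The integral over pairs at distance less than \<open>\<delta>\<close> has order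
  \<open>dyadic_coeff p \<delta> (1 - s)\<close>, the one over pairs at distance at least \<open>\<delta>\<close> has order
  \<open>dyadic_coeff p (1 / \<delta>) s\<close>.
\<close>

definition dyadic_coeff :: "real \<Rightarrow> real \<Rightarrow> real \<Rightarrow> real" where
  "dyadic_coeff p c t = c powr (t * p) / (1 - 2 powr (- (t * p)))"

text \<open>
  The limit does not depend on \<open>c\<close>: the radius that separates close and distant pairs, which depends on
  \<open>v\<close>, leaves no trace in the final constants.
\<close>

lemma tendsto_dyadic_coeff_right_0:
  fixes c p :: real
  assumes "0 < c" "0 < p"
  shows "((\<lambda>t. t * dyadic_coeff p c t) \<longlongrightarrow> 1 / (p * ln 2)) (at_right 0)"
proof -
  have "((\<lambda>t. t / (1 - 2 powr (- (t * p)))) \<longlongrightarrow> inverse (ln 2) * inverse p) (at_right 0)"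
    using assms by real_asymp
  then have "((\<lambda>t. t / (1 - 2 powr (- (t * p)))) \<longlongrightarrow> 1 / (p * ln 2)) (at_right 0)"
    by (simp add: divide_inverse mult.commute)
  moreover have "((\<lambda>t. c powr (t * p)) \<longlongrightarrow> c powr (0 * p)) (at_right 0)"
    using assms by (intro tendsto_intros) auto
  ultimately have "((\<lambda>t. t / (1 - 2 powr (- (t * p))) * c powr (t * p)) \<longlongrightarrow> 1 / (p * ln 2) * c powr (0 * p)) (at_right 0)"
    by (rule tendsto_mult)
  then have "((\<lambda>t. t * (c powr (t * p) / (1 - 2 powr (- (t * p))))) \<longlongrightarrow> 1 / (p * ln 2) * c powr (0 * p)) (at_right 0)"
    by (simp only: times_divide_eq_left times_divide_eq_right)
  moreover have "1 / (p * ln 2) * c powr (0 * p) = 1 / (p * ln 2)" using assms by simp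
  ultimately show ?thesis by (simp only: dyadic_coeff_def)
qed

lemma tendsto_dyadic_coeff_left_1:
  assumes "0 < c" "0 < p"
  shows "((\<lambda>s. (1 - s) * dyadic_coeff p c (1 - s)) \<longlongrightarrow> 1 / (p * ln 2)) (at_left 1)"
proof -
  have "filterlim (\<lambda>s::real. 1 - s) (at_right 0) (at_left 1)" by real_asymp
  from filterlim_compose[OF tendsto_dyadic_coeff_right_0[OF assms] this] show ?thesis .
qed

lemma tendsto_dyadic_coeff_1:
  assumes "0 < c" "0 < p" "(g \<longlongrightarrow> 1) F"
  shows "((\<lambda>s. dyadic_coeff p c (g s)) \<longlongrightarrow> dyadic_coeff p c 1) F"
proof -
  have "2 powr (- (1 * p)) < (1::real)" using powr_less_mono[of "- p" 0 2] assms by simp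
  then show ?thesis unfolding dyadic_coeff_def using assms
    by (intro tendsto_intros) auto
qed

lemma Limsup_le_of_tendsto:
  fixes f :: "real \<Rightarrow> ennreal"
  assumes "eventually (\<lambda>s. f s \<le> ennreal (g s)) F" "(g \<longlongrightarrow> l) F" "F \<noteq> bot"
  shows "Limsup F f \<le> ennreal l"
proof -
  have "Limsup F f \<le> Limsup F (\<lambda>s. ennreal (g s))" by (rule Limsup_mono) fact
  also have "\<dots> = ennreal l" by (intro lim_imp_Limsup tendsto_ennrealI assms)
  finally show ?thesis .
qed

lemma le_Liminf_of_tendsto:
  fixes f :: "real \<Rightarrow> ennreal"
  assumes "eventually (\<lambda>s. ennreal (g s) \<le> f s) F" "(g \<longlongrightarrow> l) F" "F \<noteq> bot"
  shows "ennreal l \<le> Liminf F f"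
proof -
  have "ennreal l = Liminf F (\<lambda>s. ennreal (g s))" by (intro lim_imp_Liminf[symmetric] tendsto_ennrealI assms)
  also have "\<dots> \<le> Liminf F f" by (rule Liminf_mono) fact
  finally show ?thesis .
qed

context doubling_measure
begin

lemma finite_powr_integral:
  fixes h :: "real^'n \<Rightarrow> real"
  assumes h: "\<And>x. 0 \<le> h x" "\<And>x. h x \<le> M" "\<And>x. h x \<noteq> 0 \<Longrightarrow> norm x < R" and p: "0 < p"
  shows "(\<integral>\<^sup>+x. ennreal (h x powr p) \<partial>\<mu>) < \<infinity>"
proof -
  have "(\<integral>\<^sup>+x. ennreal (h x powr p) \<partial>\<mu>) \<le> (\<integral>\<^sup>+x. ennreal (M powr p) * indicator (ball 0 R) x \<partial>\<mu>)"
  proof (intro nn_integral_mono)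
    fix x show "ennreal (h x powr p) \<le> ennreal (M powr p) * indicator (ball 0 R) x"
      using h(1,2)[of x] h(3)[of x] p by (cases "h x = 0") (auto intro!: ennreal_leI powr_mono2)
  qed
  also have "\<dots> = ennreal (M powr p) * emeasure \<mu> (ball 0 R)"
    by (rule nn_integral_cmult_indicator) (simp add: sets_eq_borel)
  also have "\<dots> < \<infinity>" using ball_finite[of 0 R] by (simp add: ennreal_mult_less_top)
  finally show ?thesis .
qed

text \<open>
  One choice of \<open>\<delta>\<close> serves all \<open>s\<close>, so this bound is used in both limits.  The local Lipschitz bound is
  \<open>norm (grad v x) + \<epsilon>\<close> on a ball that contains all \<open>x\<close> at distance at most \<open>1\<close> from the support.
\<close>

lemma scaled_energy_le_dyadic_coeff:
  assumes v: "v \<in> Cc_infty" and p: "0 < p" and \<epsilon>: "0 < \<epsilon>" and Lam: "0 < Lam"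
    and R: "0 < R" "\<And>x. v x \<noteq> 0 \<Longrightarrow> norm x < R" "\<And>x. grad v x \<noteq> 0 \<Longrightarrow> norm x < R"
    and i: "(\<integral>\<^sup>+x. ennreal (\<bar>v x\<bar> powr p) \<partial>\<mu>) = ennreal i" "0 \<le> i"
    and j: "(\<integral>\<^sup>+x. ennreal (norm (grad v x) powr p) \<partial>\<mu>) = ennreal j" "0 \<le> j"
    and m: "emeasure \<mu> (ball 0 (R + 1)) = ennreal m" "0 \<le> m"
  obtains \<delta> where "0 < \<delta>" "\<And>s. 0 < s \<Longrightarrow> s < 1 \<Longrightarrow> ennreal Lam * (ennreal (s * (1 - s)) * energy\<mu> p v s) \<le>
     ennreal (Lam * (s * (1 - s) * (2 * (2 powr p * (D * dyadic_coeff p (1 / \<delta>) s)) * i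
       + D * dyadic_coeff p \<delta> (1 - s) * (2 powr p * (j + \<epsilon> powr p * m)))))"
proof -
  obtain \<delta> where \<delta>: "0 < \<delta>" "\<delta> \<le> 1"
    and lin: "\<And>x y. dist x y < \<delta> \<Longrightarrow> \<bar>v x - v y - grad v x \<bullet> (x - y)\<bar> \<le> \<epsilon> * dist x y"
    using Cc_infty_uniform_linearization[OF v \<epsilon>] by blast
  define h where "h x = (norm (grad v x) + \<epsilon>) * indicator (ball 0 (R + 1)) x" for x
  have [measurable]: "v \<in> borel_measurable borel" "grad v \<in> borel_measurable borel"
    using Cc_infty_continuous[OF v] by (auto intro: borel_measurable_continuous_onI)
  have [measurable]: "ball (0::real^'n) (R + 1) \<in> sets borel" "ball (0::real^'n) (R + 1) \<in> sets \<mu>"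
    by (simp_all add: sets_eq_borel)
  have hm [measurable]: "h \<in> borel_measurable borel" unfolding h_def by measurable
  have [measurable]: "grad v \<in> borel_measurable \<mu>" by measurable
  have h0: "0 \<le> h x" for x using \<epsilon> by (simp add: h_def)
  have near: "\<bar>v x - v y\<bar> \<le> h x * dist x y" if xy: "dist x y < \<delta>" for x y
  proof (cases "norm x < R + 1")
    case True
    have "\<bar>grad v x \<bullet> (x - y)\<bar> \<le> norm (grad v x) * dist x y"
      by (simp add: dist_norm Cauchy_Schwarz_ineq2)
    then have "\<bar>v x - v y\<bar> \<le> norm (grad v x) * dist x y + \<epsilon> * dist x y"
      using lin[OF xy] by linarith
    then show ?thesis using True by (simp add: h_def distrib_right)
  next
    case False
    have "norm x \<le> norm y + dist x y"
      using norm_triangle_sub[of x y] by (simp add: dist_norm)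
    then have "R \<le> norm y" "R \<le> norm x" using False xy \<delta> by auto
    then have "v x = 0" "v y = 0" using R(2) by (meson not_less)+
    then show ?thesis using h0[of x] by simp
  qed
  have hint: "(\<integral>\<^sup>+x. ennreal (h x powr p) \<partial>\<mu>) \<le> ennreal (2 powr p * (j + \<epsilon> powr p * m))"
  proof -
    have "(\<integral>\<^sup>+x. ennreal (h x powr p) \<partial>\<mu>) \<le>
      (\<integral>\<^sup>+x. ennreal (2 powr p) * (ennreal (norm (grad v x) powr p) + ennreal (\<epsilon> powr p) * indicator (ball 0 (R + 1)) x) \<partial>\<mu>)"
    proof (intro nn_integral_mono)
      fix x
      show "ennreal (h x powr p) \<le> ennreal (2 powr p) * (ennreal (norm (grad v x) powr p) + ennreal (\<epsilon> powr p) * indicator (ball 0 (R + 1)) x)"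
      proof (cases "x \<in> ball 0 (R + 1)")
        case True
        have "ennreal (h x powr p) \<le> ennreal (2 powr p * (norm (grad v x) powr p + \<epsilon> powr p))"
          using True powr_add_le[of "norm (grad v x)" \<epsilon> p] \<epsilon> p by (intro ennreal_leI) (simp add: h_def)
        also have "\<dots> = ennreal (2 powr p) * (ennreal (norm (grad v x) powr p) + ennreal (\<epsilon> powr p))"
          by (simp only: ennreal_mult'[OF powr_ge_zero] ennreal_plus[OF powr_ge_zero powr_ge_zero])
        finally show ?thesis using True by simp
      qed (simp add: h_def)
    qed
    also have "\<dots> = ennreal (2 powr p) * (\<integral>\<^sup>+x. ennreal (norm (grad v x) powr p) + ennreal (\<epsilon> powr p) * indicator (ball 0 (R + 1)) x \<partial>\<mu>)"
      by (rule nn_integral_cmult) measurable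
    also have "(\<integral>\<^sup>+x. ennreal (norm (grad v x) powr p) + ennreal (\<epsilon> powr p) * indicator (ball 0 (R + 1)) x \<partial>\<mu>)
      = ennreal j + (\<integral>\<^sup>+x. ennreal (\<epsilon> powr p) * indicator (ball 0 (R + 1)) x \<partial>\<mu>)"
      unfolding j(1)[symmetric] by (rule nn_integral_add) measurable
    also have "(\<integral>\<^sup>+x. ennreal (\<epsilon> powr p) * indicator (ball 0 (R + 1)) x \<partial>\<mu>) = ennreal (\<epsilon> powr p) * ennreal m"
      unfolding m(1)[symmetric] by (rule nn_integral_cmult_indicator) (simp add: sets_eq_borel)
    also have "ennreal (2 powr p) * (ennreal j + ennreal (\<epsilon> powr p) * ennreal m) = ennreal (2 powr p * (j + \<epsilon> powr p * m))"
      using j(2) m(2) by (simp add: ennreal_mult ennreal_plus)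
    finally show ?thesis .
  qed
  show ?thesis
  proof (rule that[OF \<delta>(1)])
    fix s :: real assume s: "0 < s" "s < 1"
    have sp: "0 < s * p" "0 < (1 - s) * p" using s p by auto
    have pos: "0 < 1 - 2 powr (- t)" if "0 < t" for t :: real
      using powr_less_mono[of "- t" 0 2] that by simp
    have c: "0 \<le> dyadic_coeff p c s" "0 \<le> dyadic_coeff p c (1 - s)" for c
      using pos[OF sp(1)] pos[OF sp(2)] by (simp_all add: dyadic_coeff_def)
    have e1: "D * \<delta> powr (- (s * p)) / (1 - 2 powr (- (s * p))) = D * dyadic_coeff p (1 / \<delta>) s"
    proof -
      have "(1 / \<delta>) powr (s * p) = \<delta> powr (- (s * p))"
        using \<delta>(1) by (simp add: powr_divide powr_minus_divide)
      then show ?thesis by (simp add: dyadic_coeff_def)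
    qed
    have e2: "D * \<delta> powr ((1 - s) * p) / (1 - 2 powr (- ((1 - s) * p))) = D * dyadic_coeff p \<delta> (1 - s)"
      by (simp add: dyadic_coeff_def)
    have "energy\<mu> p v s \<le> ennreal (2 * (2 powr p * (D * dyadic_coeff p (1 / \<delta>) s))) * ennreal i
       + ennreal (D * dyadic_coeff p \<delta> (1 - s)) * (\<integral>\<^sup>+x. ennreal (h x powr p) \<partial>\<mu>)"
      using energy_le_far_plus_near[OF _ hm h0 \<delta>(1) p s near] unfolding e1 e2 i(1) by simp
    also have "\<dots> \<le> ennreal (2 * (2 powr p * (D * dyadic_coeff p (1 / \<delta>) s))) * ennreal i
       + ennreal (D * dyadic_coeff p \<delta> (1 - s)) * ennreal (2 powr p * (j + \<epsilon> powr p * m))"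
      by (intro add_left_mono mult_left_mono hint) simp
    also have "\<dots> = ennreal (2 * (2 powr p * (D * dyadic_coeff p (1 / \<delta>) s)) * i
       + D * dyadic_coeff p \<delta> (1 - s) * (2 powr p * (j + \<epsilon> powr p * m)))" (is "_ = ennreal ?e")
      using c D_pos i j m by (subst ennreal_plus) (auto simp: ennreal_mult simp del: ennreal_plus)
    finally have "energy\<mu> p v s \<le> ennreal ?e" .
    then have "ennreal Lam * (ennreal (s * (1 - s)) * energy\<mu> p v s) \<le> ennreal Lam * (ennreal (s * (1 - s)) * ennreal ?e)"
      by (intro mult_left_mono) auto
    also have "\<dots> = ennreal (Lam * (s * (1 - s) * ?e))"
      using Lam s by (subst ennreal_mult'[symmetric], simp)+ simp
    finally show "ennreal Lam * (ennreal (s * (1 - s)) * energy\<mu> p v s) \<le> ennreal (Lam * (s * (1 - s) * ?e))" .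
  qed
qed

lemma scaled_energy_ge:
  assumes E: "ennreal (c / D) * ennreal a \<le> E" and "0 < lam" "0 \<le> c" "0 \<le> a" "0 < s" "s < 1"
  shows "ennreal (lam * (s * (1 - s) * (c / D * a))) \<le> ennreal lam * (ennreal (s * (1 - s)) * E)"
proof -
  have "ennreal (lam * (s * (1 - s) * (c / D * a))) = ennreal lam * (ennreal (s * (1 - s)) * (ennreal (c / D) * ennreal a))"
    using assms D_pos by (simp add: ennreal_mult del: times_divide_eq_left times_divide_eq_right)
  also have "\<dots> \<le> ennreal lam * (ennreal (s * (1 - s)) * E)"
    using E by (intro mult_left_mono) auto
  finally show ?thesis .
qed

text \<open>
  The support lies in the ball of radius \<open>R\<close>, so pairs at distance at least \<open>2 * R\<close> count as distant; a
  further factor \<open>2\<close> comes from the outer radius of the shells.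
\<close>

lemma energy_ge_integral_powr:
  assumes v: "v \<in> Cc_infty" and p: "0 < p" and s: "0 < s"
    and R: "0 < R" "\<And>x. v x \<noteq> 0 \<Longrightarrow> norm x < R"
  shows "ennreal (dyadic_coeff p (1 / (4 * R)) s / D) * (\<integral>\<^sup>+x. ennreal (\<bar>v x\<bar> powr p) \<partial>\<mu>) \<le> energy\<mu> p v s"
proof -
  have vm: "v \<in> borel_measurable borel"
    using Cc_infty_continuous[OF v] by (auto intro: borel_measurable_continuous_onI)
  have "(1 / (4 * R)) powr (s * p) = (2 * (2 * R)) powr (- (s * p))"
    using R(1) by (simp add: powr_divide powr_minus_divide)
  then have e: "(2 * (2 * R)) powr (- (s * p)) / (D * (1 - 2 powr (- (s * p)))) = dyadic_coeff p (1 / (4 * R)) s / D"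
    by (simp add: dyadic_coeff_def mult.commute)
  show ?thesis
    unfolding e[symmetric] by (rule energy_ge_far[OF vm _ p s]) (use R in auto)
qed

text \<open>
  On the cone around \<open>grad v x\<close> the linear part of \<open>v x - v y\<close> is at least half of
  \<open>norm (grad v x) * dist x y\<close>.  Where \<open>4 * \<epsilon> \<le> norm (grad v x)\<close>, the error \<open>\<epsilon> * dist x y\<close> takes away at most
  half of this, and the points with a smaller gradient contribute at most \<open>\<epsilon> powr p * m\<close> to the integral.
\<close>

lemma energy_ge_integral_grad:
  assumes v: "v \<in> Cc_infty" and p: "0 < p" and \<epsilon>: "0 < \<epsilon>"
    and R: "0 < R" "\<And>x. grad v x \<noteq> 0 \<Longrightarrow> norm x < R"
    and j: "(\<integral>\<^sup>+x. ennreal (norm (grad v x) powr p) \<partial>\<mu>) = ennreal j" "0 \<le> j"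
    and m: "emeasure \<mu> (ball 0 R) = ennreal m" "0 \<le> m"
  obtains \<delta> a where "0 < \<delta>" "0 \<le> a" "4 powr (- p) * j - \<epsilon> powr p * m \<le> a"
    "\<And>s. s < 1 \<Longrightarrow> ennreal (dyadic_coeff p \<delta> (1 - s) / D) * ennreal a \<le> energy\<mu> p v s"
proof -
  obtain \<delta> where \<delta>: "0 < \<delta>" "\<delta> \<le> 1"
    and lin: "\<And>x y. dist x y < \<delta> \<Longrightarrow> \<bar>v x - v y - grad v x \<bullet> (x - y)\<bar> \<le> \<epsilon> * dist x y"
    using Cc_infty_uniform_linearization[OF v \<epsilon>] by blast
  define h where "h x = (if 4 * \<epsilon> \<le> norm (grad v x) then norm (grad v x) / 4 else 0)" for x
  define e where "e x = (if grad v x = 0 then axis undefined 1 else grad v x /\<^sub>R norm (grad v x))" for x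
  have [measurable]: "grad v \<in> borel_measurable borel"
    using Cc_infty_continuous[OF v] by (auto intro: borel_measurable_continuous_onI)
  then have [measurable]: "grad v \<in> borel_measurable \<mu>" by measurable
  have [measurable]: "ball (0::real^'n) R \<in> sets \<mu>" by (simp add: sets_eq_borel)
  have hm: "h \<in> borel_measurable borel" unfolding h_def by measurable
  then have [measurable]: "h \<in> borel_measurable \<mu>" by measurable
  have h0: "0 \<le> h x" for x by (simp add: h_def)
  have e1: "norm (e x) = 1" for x by (simp add: e_def)
  have near: "h x * dist x y \<le> \<bar>v x - v y\<bar>" if xy: "dist x y < \<delta>" and c: "y \<in> cone x (e x)" for x y
  proof (cases "4 * \<epsilon> \<le> norm (grad v x)")
    case True
    then have g: "grad v x \<noteq> 0" using \<epsilon> by auto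
    have "grad v x = norm (grad v x) *\<^sub>R e x" using g by (simp add: e_def)
    then have "grad v x \<bullet> (x - y) = norm (grad v x) * (e x \<bullet> (x - y))" by (metis inner_scaleR_left)
    then have "\<bar>grad v x \<bullet> (x - y)\<bar> = norm (grad v x) * \<bar>e x \<bullet> (x - y)\<bar>" by (simp add: abs_mult)
    also have "\<bar>e x \<bullet> (x - y)\<bar> = \<bar>e x \<bullet> (y - x)\<bar>" by (simp add: inner_diff_right abs_minus_commute)
    finally have "norm (grad v x) * (dist x y / 2) \<le> \<bar>grad v x \<bullet> (x - y)\<bar>"
      using c by (simp only: cone_def mem_Collect_eq mult_left_mono norm_ge_zero)
    moreover have "\<epsilon> * dist x y \<le> norm (grad v x) / 4 * dist x y"
      using True by (intro mult_right_mono) auto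
    moreover have "norm (grad v x) / 4 * dist x y = norm (grad v x) * (dist x y / 2) - norm (grad v x) / 4 * dist x y"
      by (simp add: field_simps)
    ultimately show ?thesis using lin[OF xy] True by (simp only: h_def if_True)
  qed (simp add: h_def)
  have "(\<integral>\<^sup>+x. ennreal (h x powr p) \<partial>\<mu>) \<le> (\<integral>\<^sup>+x. ennreal (norm (grad v x) powr p) \<partial>\<mu>)"
    using p by (intro nn_integral_mono ennreal_leI powr_mono2) (auto simp: h_def)
  then have "(\<integral>\<^sup>+x. ennreal (h x powr p) \<partial>\<mu>) < \<infinity>" unfolding j(1) by (rule le_less_trans) simp
  then obtain a where a: "(\<integral>\<^sup>+x. ennreal (h x powr p) \<partial>\<mu>) = ennreal a" "0 \<le> a"
    by (metis ennreal_cases infinity_ennreal_def less_irrefl)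
  have "ennreal (4 powr (- p)) * ennreal j \<le> ennreal a + ennreal (\<epsilon> powr p) * ennreal m"
  proof -
    have "ennreal (4 powr (- p)) * ennreal j = (\<integral>\<^sup>+x. ennreal (4 powr (- p)) * ennreal (norm (grad v x) powr p) \<partial>\<mu>)"
      unfolding j(1)[symmetric] by (rule nn_integral_cmult[symmetric]) measurable
    also have "\<dots> \<le> (\<integral>\<^sup>+x. ennreal (h x powr p) + ennreal (\<epsilon> powr p) * indicator (ball 0 R) x \<partial>\<mu>)"
    proof (intro nn_integral_mono)
      fix x
      have q: "4 powr (- p) * norm (grad v x) powr p = (norm (grad v x) / 4) powr p"
        by (simp add: powr_divide powr_minus_divide)
      show "ennreal (4 powr (- p)) * ennreal (norm (grad v x) powr p) \<le> ennreal (h x powr p) + ennreal (\<epsilon> powr p) * indicator (ball 0 R) x"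
      proof (cases "4 * \<epsilon> \<le> norm (grad v x)")
        case True
        have "ennreal (4 powr (- p)) * ennreal (norm (grad v x) powr p) = ennreal (h x powr p)"
          using True by (simp add: h_def q flip: ennreal_mult)
        then show ?thesis by (simp add: add_increasing2)
      next
        case False
        show ?thesis
        proof (cases "grad v x = 0")
          case g: False
          have "(norm (grad v x) / 4) powr p \<le> \<epsilon> powr p"
            using False p by (intro powr_mono2) auto
          then have "ennreal (4 powr (- p)) * ennreal (norm (grad v x) powr p) \<le> ennreal (\<epsilon> powr p)"
            by (subst ennreal_mult[symmetric]) (auto simp: q intro!: ennreal_leI)
          then show ?thesis using R(2)[OF g] by (simp add: add_increasing)
        qed simp
      qed
    qed
    also have "\<dots> = ennreal a + (\<integral>\<^sup>+x. ennreal (\<epsilon> powr p) * indicator (ball 0 R) x \<partial>\<mu>)"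
      unfolding a(1)[symmetric] by (rule nn_integral_add) measurable
    also have "(\<integral>\<^sup>+x. ennreal (\<epsilon> powr p) * indicator (ball 0 R) x \<partial>\<mu>) = ennreal (\<epsilon> powr p) * ennreal m"
      unfolding m(1)[symmetric] by (rule nn_integral_cmult_indicator) measurable
    finally show ?thesis .
  qed
  then have "ennreal (4 powr (- p) * j) \<le> ennreal (a + \<epsilon> powr p * m)"
    using j m a by (simp add: ennreal_mult ennreal_plus)
  then have "4 powr (- p) * j - \<epsilon> powr p * m \<le> a"
    using m a by (subst (asm) ennreal_le_iff) auto
  moreover have "ennreal (dyadic_coeff p (\<delta> / 2) (1 - s) / D) * ennreal a \<le> energy\<mu> p v s" if "s < 1" for s
  proof -
    have eq: "(\<delta> / 2) powr ((1 - s) * p) / (D * (1 - 2 powr (- ((1 - s) * p)))) = dyadic_coeff p (\<delta> / 2) (1 - s) / D"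
      by (simp add: dyadic_coeff_def mult.commute)
    show ?thesis
      using energy_ge_near[OF hm h0 \<delta>(1) p that e1 near] unfolding eq a(1) by simp
  qed
  ultimately show ?thesis using that[of "\<delta> / 2" a] \<delta>(1) a(2) by simp
qed

text \<open>
  At \<open>0\<close> the term with \<open>dyadic_coeff p _ (1 - s)\<close> stays bounded and is killed by the factor \<open>s\<close>; at \<open>1\<close> the
  two terms exchange their roles.  In the limit at \<open>1\<close> the error \<open>\<epsilon>\<close> is removed only after the limit in
  \<open>s\<close>, since \<open>\<delta>\<close> depends on \<open>\<epsilon>\<close>.
\<close>

lemma energy_limits:
  assumes v: "v \<in> Cc_infty" and p: "0 < p" and lam: "0 < lam" and Lam: "0 < Lam"
    and lower: "\<And>s. 0 < s \<Longrightarrow> s < 1 \<Longrightarrow> ennreal lam * (ennreal (s * (1 - s)) * energy\<mu> p v s) \<le> f s"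
    and upper: "\<And>s. 0 < s \<Longrightarrow> s < 1 \<Longrightarrow> f s \<le> ennreal Lam * (ennreal (s * (1 - s)) * energy\<mu> p v s)"
  shows "ennreal (lam / (D * (p * ln 2))) * (\<integral>\<^sup>+x. ennreal (\<bar>v x\<bar> powr p) \<partial>\<mu>) \<le> Liminf (at_right 0) f" (is ?A)
    and "Limsup (at_right 0) f \<le> ennreal (2 * Lam * 2 powr p * D / (p * ln 2)) * (\<integral>\<^sup>+x. ennreal (\<bar>v x\<bar> powr p) \<partial>\<mu>)" (is ?B)
    and "ennreal (lam * 4 powr (- p) / (D * (p * ln 2))) * (\<integral>\<^sup>+x. ennreal (norm (grad v x) powr p) \<partial>\<mu>) \<le> Liminf (at_left 1) f" (is ?C)
    and "Limsup (at_left 1) f \<le> ennreal (Lam * 2 powr p * D / (p * ln 2)) * (\<integral>\<^sup>+x. ennreal (norm (grad v x) powr p) \<partial>\<mu>)" (is ?E)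
proof -
  define \<kappa> where "\<kappa> = 1 / (p * ln 2)"
  have \<kappa>: "0 < \<kappa>" using p by (simp add: \<kappa>_def)
  obtain R where R: "0 < R" "\<And>x. v x \<noteq> 0 \<Longrightarrow> norm x < R" "\<And>x. grad v x \<noteq> 0 \<Longrightarrow> norm x < R"
    using Cc_infty_support[OF v] by metis
  obtain M where M: "\<And>x. norm (v x) \<le> M"
    using bounded_of_support[OF Cc_infty_continuous(1)[OF v] R(2)] by blast
  obtain M' where M': "\<And>x. norm (grad v x) \<le> M'"
    using bounded_of_support[OF Cc_infty_continuous(2)[OF v] R(3)] by blast
  have "(\<integral>\<^sup>+x. ennreal (\<bar>v x\<bar> powr p) \<partial>\<mu>) < \<infinity>"
    by (rule finite_powr_integral[of "\<lambda>x. \<bar>v x\<bar>" M R p]) (use M R p in auto)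
  then obtain i where i: "(\<integral>\<^sup>+x. ennreal (\<bar>v x\<bar> powr p) \<partial>\<mu>) = ennreal i" "0 \<le> i"
    by (metis ennreal_cases infinity_ennreal_def less_irrefl)
  have "(\<integral>\<^sup>+x. ennreal (norm (grad v x) powr p) \<partial>\<mu>) < \<infinity>"
    by (rule finite_powr_integral[of "\<lambda>x. norm (grad v x)" M' R p]) (use M' R p in auto)
  then obtain j where j: "(\<integral>\<^sup>+x. ennreal (norm (grad v x) powr p) \<partial>\<mu>) = ennreal j" "0 \<le> j"
    by (metis ennreal_cases infinity_ennreal_def less_irrefl)
  obtain m where m: "emeasure \<mu> (ball 0 (R + 1)) = ennreal m" "0 \<le> m"
    using ball_finite by (metis ennreal_cases infinity_ennreal_def less_irrefl)
  obtain m' where m': "emeasure \<mu> (ball 0 R) = ennreal m'" "0 \<le> m'"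
    using ball_finite by (metis ennreal_cases infinity_ennreal_def less_irrefl)
  have ev0: "eventually P (at_right (0::real))" if "\<And>s. 0 < s \<Longrightarrow> s < 1 \<Longrightarrow> P s" for P
    using that by (auto simp: eventually_at_right_field intro: exI[of _ 1])
  have ev1: "eventually P (at_left (1::real))" if "\<And>s. 0 < s \<Longrightarrow> s < 1 \<Longrightarrow> P s" for P
    using that by (auto simp: eventually_at_left_field intro: exI[of _ 0])
  have coeff0: "0 \<le> dyadic_coeff p c t" if "0 < t" for c t
  proof -
    have "2 powr (- (t * p)) < (1::real)" using powr_less_mono[of "- (t * p)" 0 2] that p by simp
    then show ?thesis by (simp add: dyadic_coeff_def)
  qed
  have id0: "((\<lambda>s::real. s) \<longlongrightarrow> 0) (at_right 0)" and id1: "((\<lambda>s::real. s) \<longlongrightarrow> 1) (at_left 1)"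
    by (rule tendsto_ident_at)+
  have co0: "((\<lambda>s::real. 1 - s) \<longlongrightarrow> 1) (at_right 0)" using tendsto_diff[OF tendsto_const id0, of 1] by simp
  have co1: "((\<lambda>s::real. 1 - s) \<longlongrightarrow> 0) (at_left 1)" using tendsto_diff[OF tendsto_const id1, of 1] by simp

  have upper_real: "\<exists>\<delta>>0. \<forall>s. 0 < s \<longrightarrow> s < 1 \<longrightarrow> f s \<le>
     ennreal (Lam * (s * (1 - s) * (2 * (2 powr p * (D * dyadic_coeff p (1 / \<delta>) s)) * i
       + D * dyadic_coeff p \<delta> (1 - s) * (2 powr p * (j + \<epsilon> powr p * m)))))" if \<epsilon>: "0 < \<epsilon>" for \<epsilon>
  proof -
    obtain \<delta> where "0 < \<delta>" "\<And>s. 0 < s \<Longrightarrow> s < 1 \<Longrightarrow> ennreal Lam * (ennreal (s * (1 - s)) * energy\<mu> p v s) \<le>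
     ennreal (Lam * (s * (1 - s) * (2 * (2 powr p * (D * dyadic_coeff p (1 / \<delta>) s)) * i
       + D * dyadic_coeff p \<delta> (1 - s) * (2 powr p * (j + \<epsilon> powr p * m)))))"
      using scaled_energy_le_dyadic_coeff[OF v p \<epsilon> Lam R i j m] by blast
    then show ?thesis using upper by (meson order_trans)
  qed
  show ?A
  proof -
    let ?c = "\<lambda>s. dyadic_coeff p (1 / (4 * R)) s"
    have "ennreal (lam * ((1 - 0) * (\<kappa> / D * i))) \<le> Liminf (at_right 0) f"
    proof (rule le_Liminf_of_tendsto)
      show "eventually (\<lambda>s. ennreal (lam * ((1 - s) * (s * ?c s / D * i))) \<le> f s) (at_right 0)"
      proof (rule ev0)
        fix s :: real assume s: "0 < s" "s < 1"
        have "ennreal (?c s / D) * ennreal i \<le> energy\<mu> p v s"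
          using energy_ge_integral_powr[OF v p s(1) R(1,2)] by (simp add: i(1))
        then have "ennreal (lam * (s * (1 - s) * (?c s / D * i))) \<le> ennreal lam * (ennreal (s * (1 - s)) * energy\<mu> p v s)"
          by (rule scaled_energy_ge) (use lam i(2) s coeff0 in auto)
        also have "\<dots> \<le> f s" by (rule lower[OF s])
        finally show "ennreal (lam * ((1 - s) * (s * ?c s / D * i))) \<le> f s" by (simp add: mult_ac)
      qed
      show "((\<lambda>s. lam * ((1 - s) * (s * ?c s / D * i))) \<longlongrightarrow> lam * ((1 - 0) * (\<kappa> / D * i))) (at_right 0)"
        unfolding \<kappa>_def using R(1) p D_pos by (intro tendsto_intros tendsto_dyadic_coeff_right_0 id0) auto
    qed simp
    moreover have "lam * ((1 - 0) * (\<kappa> / D * i)) = lam / (D * (p * ln 2)) * i" by (simp add: \<kappa>_def)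
    ultimately have "ennreal (lam / (D * (p * ln 2)) * i) \<le> Liminf (at_right 0) f" by (simp only:)
    then show ?thesis unfolding i(1) ennreal_mult''[OF i(2)] .
  qed
  show ?B
  proof -
    obtain \<delta> where \<delta>: "0 < \<delta>" and le: "\<And>s. 0 < s \<Longrightarrow> s < 1 \<Longrightarrow> f s \<le>
     ennreal (Lam * (s * (1 - s) * (2 * (2 powr p * (D * dyadic_coeff p (1 / \<delta>) s)) * i
       + D * dyadic_coeff p \<delta> (1 - s) * (2 powr p * (j + 1 powr p * m)))))"
      using upper_real[of 1] by auto
    let ?a = "dyadic_coeff p (1 / \<delta>)" and ?b = "dyadic_coeff p \<delta>"
    have "Limsup (at_right 0) f \<le> ennreal (Lam * ((1 - 0) * (2 * 2 powr p * D * i * \<kappa>) + 0 * (1 - 0) * (D * ?b 1 * (2 powr p * (j + 1 powr p * m)))))"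
    proof (rule Limsup_le_of_tendsto)
      show "eventually (\<lambda>s. f s \<le> ennreal (Lam * ((1 - s) * (2 * 2 powr p * D * i * (s * ?a s)) + s * (1 - s) * (D * ?b (1 - s) * (2 powr p * (j + 1 powr p * m)))))) (at_right 0)"
      proof (rule ev0)
        fix s :: real assume s: "0 < s" "s < 1"
        have "Lam * (s * (1 - s) * (2 * (2 powr p * (D * ?a s)) * i + D * ?b (1 - s) * (2 powr p * (j + 1 powr p * m))))
          = Lam * ((1 - s) * (2 * 2 powr p * D * i * (s * ?a s)) + s * (1 - s) * (D * ?b (1 - s) * (2 powr p * (j + 1 powr p * m))))"
          by (simp only: distrib_left mult_ac)
        with le[OF s] show "f s \<le> ennreal (Lam * ((1 - s) * (2 * 2 powr p * D * i * (s * ?a s)) + s * (1 - s) * (D * ?b (1 - s) * (2 powr p * (j + 1 powr p * m)))))"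
          by (simp only:)
      qed
      show "((\<lambda>s. Lam * ((1 - s) * (2 * 2 powr p * D * i * (s * ?a s)) + s * (1 - s) * (D * ?b (1 - s) * (2 powr p * (j + 1 powr p * m)))))
        \<longlongrightarrow> Lam * ((1 - 0) * (2 * 2 powr p * D * i * \<kappa>) + 0 * (1 - 0) * (D * ?b 1 * (2 powr p * (j + 1 powr p * m))))) (at_right 0)"
        unfolding \<kappa>_def using \<delta> p
        by (intro tendsto_add tendsto_mult tendsto_diff tendsto_const tendsto_dyadic_coeff_right_0 tendsto_dyadic_coeff_1 id0 co0) auto
    qed simp
    moreover have "Lam * ((1 - 0) * (2 * 2 powr p * D * i * \<kappa>) + 0 * (1 - 0) * (D * ?b 1 * (2 powr p * (j + 1 powr p * m))))
       = 2 * Lam * 2 powr p * D / (p * ln 2) * i" by (simp add: \<kappa>_def)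
    ultimately have "Limsup (at_right 0) f \<le> ennreal (2 * Lam * 2 powr p * D / (p * ln 2) * i)" by (simp only:)
    then show ?thesis unfolding i(1) ennreal_mult''[OF i(2)] .
  qed
  show ?C
  proof -
    have b: "ennreal (lam * \<kappa> / D * (4 powr (- p) * j - \<epsilon> powr p * m')) \<le> Liminf (at_left 1) f" if \<epsilon>: "0 < \<epsilon>" for \<epsilon>
    proof -
      obtain \<delta> a where \<delta>: "0 < \<delta>" and a: "0 \<le> a" "4 powr (- p) * j - \<epsilon> powr p * m' \<le> a"
        and le: "\<And>s. s < 1 \<Longrightarrow> ennreal (dyadic_coeff p \<delta> (1 - s) / D) * ennreal a \<le> energy\<mu> p v s"
        using energy_ge_integral_grad[OF v p \<epsilon> R(1,3) j m'] by blast
      let ?c = "\<lambda>s. dyadic_coeff p \<delta> (1 - s)"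
      have "ennreal (lam * \<kappa> / D * (4 powr (- p) * j - \<epsilon> powr p * m')) \<le> ennreal (lam * (1 * (\<kappa> / D * a)))"
      proof (rule ennreal_leI)
        have "lam * \<kappa> / D * (4 powr (- p) * j - \<epsilon> powr p * m') \<le> lam * \<kappa> / D * a"
          using a lam \<kappa> D_pos by (intro mult_left_mono) auto
        then show "lam * \<kappa> / D * (4 powr (- p) * j - \<epsilon> powr p * m') \<le> lam * (1 * (\<kappa> / D * a))" by simp
      qed
      also have "\<dots> \<le> Liminf (at_left 1) f"
      proof (rule le_Liminf_of_tendsto)
        show "eventually (\<lambda>s. ennreal (lam * (s * ((1 - s) * ?c s / D * a))) \<le> f s) (at_left 1)"
        proof (rule ev1)
          fix s :: real assume s: "0 < s" "s < 1"
          have "ennreal (lam * (s * (1 - s) * (?c s / D * a))) \<le> ennreal lam * (ennreal (s * (1 - s)) * energy\<mu> p v s)"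
            by (rule scaled_energy_ge[OF le]) (use lam a s coeff0 in auto)
          also have "\<dots> \<le> f s" by (rule lower[OF s])
          finally show "ennreal (lam * (s * ((1 - s) * ?c s / D * a))) \<le> f s" by (simp add: mult_ac)
        qed
        show "((\<lambda>s. lam * (s * ((1 - s) * ?c s / D * a))) \<longlongrightarrow> lam * (1 * (\<kappa> / D * a))) (at_left 1)"
          unfolding \<kappa>_def using \<delta> p D_pos by (intro tendsto_intros tendsto_dyadic_coeff_left_1 id1) auto
      qed simp
      finally show ?thesis .
    qed
    have "((\<lambda>\<epsilon>. \<epsilon> powr p) \<longlongrightarrow> 0) (at_right (0::real))" using p by real_asymp
    then have "((\<lambda>\<epsilon>. ennreal (lam * \<kappa> / D * (4 powr (- p) * j - \<epsilon> powr p * m'))) \<longlongrightarrow> ennreal (lam * \<kappa> / D * (4 powr (- p) * j - 0 * m'))) (at_right 0)"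
      by (intro tendsto_ennrealI tendsto_mult tendsto_diff tendsto_const)
    then have "ennreal (lam * \<kappa> / D * (4 powr (- p) * j - 0 * m')) \<le> Liminf (at_left 1) f"
      by (rule tendsto_upperbound) (use b in \<open>auto intro!: ev0\<close>)
    moreover have "lam * \<kappa> / D * (4 powr (- p) * j - 0 * m') = lam * 4 powr (- p) / (D * (p * ln 2)) * j"
      by (simp add: \<kappa>_def mult.commute mult.left_commute)
    ultimately have "ennreal (lam * 4 powr (- p) / (D * (p * ln 2)) * j) \<le> Liminf (at_left 1) f" by (simp only:)
    then show ?thesis unfolding j(1) ennreal_mult''[OF j(2)] .
  qed
  show ?E
  proof -
    have b: "Limsup (at_left 1) f \<le> ennreal (Lam * (D * \<kappa> * (2 powr p * (j + \<epsilon> powr p * m))))" if \<epsilon>: "0 < \<epsilon>" for \<epsilon>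
    proof -
      obtain \<delta> where \<delta>: "0 < \<delta>" and le: "\<And>s. 0 < s \<Longrightarrow> s < 1 \<Longrightarrow> f s \<le>
         ennreal (Lam * (s * (1 - s) * (2 * (2 powr p * (D * dyadic_coeff p (1 / \<delta>) s)) * i
           + D * dyadic_coeff p \<delta> (1 - s) * (2 powr p * (j + \<epsilon> powr p * m)))))"
        using upper_real[OF \<epsilon>] by auto
      let ?a = "dyadic_coeff p (1 / \<delta>)" and ?b = "dyadic_coeff p \<delta>" and ?j = "2 powr p * (j + \<epsilon> powr p * m)"
      have "Limsup (at_left 1) f \<le> ennreal (Lam * (1 * 0 * (2 * 2 powr p * D * i * ?a 1) + 1 * (D * \<kappa> * ?j)))"
      proof (rule Limsup_le_of_tendsto)
        show "eventually (\<lambda>s. f s \<le> ennreal (Lam * (s * (1 - s) * (2 * 2 powr p * D * i * ?a s) + s * (D * ((1 - s) * ?b (1 - s)) * ?j)))) (at_left 1)"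
        proof (rule ev1)
          fix s :: real assume s: "0 < s" "s < 1"
          have "Lam * (s * (1 - s) * (2 * (2 powr p * (D * ?a s)) * i + D * ?b (1 - s) * ?j))
            = Lam * (s * (1 - s) * (2 * 2 powr p * D * i * ?a s) + s * (D * ((1 - s) * ?b (1 - s)) * ?j))"
            by (simp only: distrib_left mult_ac)
          with le[OF s] show "f s \<le> ennreal (Lam * (s * (1 - s) * (2 * 2 powr p * D * i * ?a s) + s * (D * ((1 - s) * ?b (1 - s)) * ?j)))"
            by (simp only:)
        qed
        show "((\<lambda>s. Lam * (s * (1 - s) * (2 * 2 powr p * D * i * ?a s) + s * (D * ((1 - s) * ?b (1 - s)) * ?j)))
          \<longlongrightarrow> Lam * (1 * 0 * (2 * 2 powr p * D * i * ?a 1) + 1 * (D * \<kappa> * ?j))) (at_left 1)"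
          unfolding \<kappa>_def using \<delta> p
          by (intro tendsto_add tendsto_mult[OF tendsto_const] tendsto_mult[OF _ tendsto_const] tendsto_mult[OF id1] tendsto_mult[OF tendsto_mult[OF id1 co1]]
             tendsto_dyadic_coeff_left_1 tendsto_dyadic_coeff_1[where g = "\<lambda>s. s"] id1 co1) auto
      qed simp
      then show ?thesis by simp
    qed
    have "((\<lambda>\<epsilon>. \<epsilon> powr p) \<longlongrightarrow> 0) (at_right (0::real))" using p by real_asymp
    then have "((\<lambda>\<epsilon>. ennreal (Lam * (D * \<kappa> * (2 powr p * (j + \<epsilon> powr p * m))))) \<longlongrightarrow> ennreal (Lam * (D * \<kappa> * (2 powr p * (j + 0 * m))))) (at_right 0)"
      by (intro tendsto_ennrealI tendsto_mult tendsto_add tendsto_const)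
    then have "Limsup (at_left 1) f \<le> ennreal (Lam * (D * \<kappa> * (2 powr p * (j + 0 * m))))"
      by (rule tendsto_lowerbound) (use b in \<open>auto intro!: ev0\<close>)
    moreover have "Lam * (D * \<kappa> * (2 powr p * (j + 0 * m))) = Lam * 2 powr p * D / (p * ln 2) * j"
      by (simp add: \<kappa>_def)
    ultimately have "Limsup (at_left 1) f \<le> ennreal (Lam * 2 powr p * D / (p * ln 2) * j)" by (simp only:)
    then show ?thesis unfolding j(1) ennreal_mult''[OF j(2)] .
  qed
qed

end

section \<open>Muckenhoupt weights\<close>

text \<open>
  A form of Hoelder's inequality for \<open>1 = g powr (1 / p) * g powr (- 1 / p)\<close>, with the constant \<open>2 powr p\<close>.  It
  follows from the elementary bound \<open>1 \<le> u + u powr q\<close> for \<open>u > 0\<close> and \<open>q < 0\<close>, applied to \<open>u = t * g x\<close>: the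
  number \<open>t\<close> is chosen such that the integral of the first summand is half of the measure of \<open>B\<close>.
\<close>

lemma measure_powr_le_dual_integrals:
  fixes g :: "real^'n \<Rightarrow> real"
  assumes [measurable]: "g \<in> borel_measurable borel" "B \<in> sets borel"
    and pos: "AE x in lborel. 0 < g x" and p: "1 < p"
    and \<alpha>: "(\<integral>\<^sup>+x\<in>B. ennreal (g x) \<partial>lborel) = ennreal \<alpha>" "0 < \<alpha>"
    and \<beta>: "(\<integral>\<^sup>+x\<in>B. ennreal (g x powr (1 / (1 - p))) \<partial>lborel) = ennreal \<beta>" "0 \<le> \<beta>"
    and m: "emeasure lborel B = ennreal m" "0 < m"
  shows "(m / 2) powr p \<le> \<alpha> * \<beta> powr (p - 1)"
proof -
  \<comment> \<open>the choice that gives \<open>t * \<alpha> = m / 2\<close>, so that the second summand has to account for the other half of \<open>m\<close>\<close>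
  define t where "t = m / (2 * \<alpha>)"
  define q where "q = 1 / (1 - p)"
  have t: "0 < t" using \<alpha> m by (simp add: t_def)
  have q: "q < 0" "q * (p - 1) = -1" using p by (auto simp: q_def field_simps)
  \<comment> \<open>one of the two summands is at least 1, depending on whether \<open>t * g x\<close> is\<close>
  have one: "1 \<le> t * g x + t powr q * g x powr q" if "0 < g x" for x
  proof (cases "1 \<le> t * g x")
    case True
    then show ?thesis by (simp add: add_increasing2)
  next
    case False
    then have "1 powr q \<le> (t * g x) powr q" using that t q by (intro powr_mono2') auto
    also have "\<dots> = t powr q * g x powr q" using that t by (simp add: powr_mult)
    finally show ?thesis using that t by (simp add: add_increasing)
  qed
  have "ennreal m = (\<integral>\<^sup>+x. indicator B x \<partial>lborel)" using m(1) by simp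
  also have "\<dots> \<le> (\<integral>\<^sup>+x. ennreal t * (ennreal (g x) * indicator B x) + ennreal (t powr q) * (ennreal (g x powr q) * indicator B x) \<partial>lborel)"
  proof (rule nn_integral_mono_AE, use pos in eventually_elim)
    fix x assume "0 < g x"
    from one[OF this] have "ennreal 1 \<le> ennreal (t * g x + t powr q * g x powr q)" by (rule ennreal_leI)
    also have "\<dots> = ennreal t * ennreal (g x) + ennreal (t powr q) * ennreal (g x powr q)"
      using t \<open>0 < g x\<close> by (simp add: ennreal_mult ennreal_plus)
    finally show "indicator B x \<le> ennreal t * (ennreal (g x) * indicator B x) + ennreal (t powr q) * (ennreal (g x powr q) * indicator B x)"
      by (auto split: split_indicator)
  qed
  also have "\<dots> = (\<integral>\<^sup>+x. ennreal t * (ennreal (g x) * indicator B x) \<partial>lborel) + (\<integral>\<^sup>+x. ennreal (t powr q) * (ennreal (g x powr q) * indicator B x) \<partial>lborel)"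
    by (rule nn_integral_add) measurable
  also have "(\<integral>\<^sup>+x. ennreal t * (ennreal (g x) * indicator B x) \<partial>lborel) = ennreal t * ennreal \<alpha>"
    unfolding \<alpha>(1)[symmetric] by (rule nn_integral_cmult) measurable
  also have "(\<integral>\<^sup>+x. ennreal (t powr q) * (ennreal (g x powr q) * indicator B x) \<partial>lborel) = ennreal (t powr q) * ennreal \<beta>"
    unfolding \<beta>(1)[symmetric] q_def by (rule nn_integral_cmult) measurable
  also have "ennreal t * ennreal \<alpha> + ennreal (t powr q) * ennreal \<beta> = ennreal (t * \<alpha> + t powr q * \<beta>)"
    using t \<alpha> \<beta> by (simp add: ennreal_mult ennreal_plus)
  finally have "m \<le> t * \<alpha> + t powr q * \<beta>"
    using t \<alpha>(2) \<beta>(2) by (subst (asm) ennreal_le_iff) auto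
  moreover have "t * \<alpha> = m / 2" using \<alpha>(2) by (simp add: t_def)
  ultimately have "m / 2 \<le> t powr q * \<beta>" by linarith
  then have "(m / 2) powr (p - 1) \<le> (t powr q * \<beta>) powr (p - 1)"
    using m p by (intro powr_mono2) auto
  also have "\<dots> = t powr (-1) * \<beta> powr (p - 1)"
    using \<beta>(2) by (simp add: powr_mult powr_powr q(2))
  also have "t powr (-1) = \<alpha> / (m / 2)" using t m \<alpha> by (simp add: powr_minus_divide t_def)
  finally have "(m / 2) * (m / 2) powr (p - 1) \<le> \<alpha> * \<beta> powr (p - 1)"
    using m by (simp add: field_simps)
  moreover have "(m / 2) * (m / 2) powr (p - 1) = (m / 2) powr p"
    using powr_add[of "m / 2" 1 "p - 1"] m by simp
  ultimately show ?thesis by simp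
qed

lemma obtain_positive_real:
  fixes x :: ennreal
  assumes "0 < x" "x < \<infinity>"
  obtains a where "x = ennreal a" "0 < a"
  using assms by (cases x) auto

text \<open>
  A Borel version of the weight gives a measure on the Borel sets, so that product measures and
  Tonelli's theorem can be used without the completion.
\<close>

lemma weight_borel_version:
  fixes w :: "real^'n \<Rightarrow> real"
  assumes "weight w"
  obtains g where "g \<in> borel_measurable borel" "AE x in lborel. w x = g x" "AE x in lborel. 0 < g x"
    "\<And>x r. (\<integral>\<^sup>+y\<in>ball x r. ennreal (g y) \<partial>lborel) < \<infinity>"
proof -
  have int: "set_integrable lebesgue (cball 0 (real n)) w" for n
    using assms by (auto simp: weight_def L1_loc_def)
  have "w \<in> borel_measurable lebesgue"
  proof (rule borel_measurable_LIMSEQ_real)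
    show "(\<lambda>x. indicat_real (cball 0 (real n)) x *\<^sub>R w x) \<in> borel_measurable lebesgue" for n
      using int[of n] unfolding set_integrable_def by (rule borel_measurable_integrable)
    fix x :: "real^'n"
    obtain N where N: "norm x \<le> real N" using real_arch_simple by blast
    have "eventually (\<lambda>n. indicat_real (cball 0 (real n)) x *\<^sub>R w x = w x) sequentially"
      using eventually_ge_at_top[of N]
    proof eventually_elim
      case (elim n)
      then have "norm x \<le> real n" using N by (meson of_nat_le_iff order_trans)
      then show ?case by simp
    qed
    then show "(\<lambda>n. indicat_real (cball 0 (real n)) x *\<^sub>R w x) \<longlonglongrightarrow> w x"
      by (rule tendsto_eventually)
  qed
  then obtain g where g: "g \<in> borel_measurable lborel" "AE x in lborel. w x = g x"
    using completion_ex_borel_measurable_real by blast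
  have g0: "AE x in lborel. 0 < g x"
  proof -
    have "AE x in lborel. 0 < w x" using assms by (simp add: weight_def AE_completion_iff)
    with g(2) show ?thesis by eventually_elim simp
  qed
  have fin: "(\<integral>\<^sup>+y\<in>ball x r. ennreal (g y) \<partial>lborel) < \<infinity>" for x :: "real^'n" and r
  proof -
    have "set_integrable lebesgue (cball x r) w" using assms by (auto simp: weight_def L1_loc_def)
    then have "(\<integral>\<^sup>+y. ennreal (norm (indicat_real (cball x r) y *\<^sub>R w y)) \<partial>lebesgue) < \<infinity>"
      unfolding set_integrable_def integrable_iff_bounded by blast
    also have "(\<integral>\<^sup>+y. ennreal (norm (indicat_real (cball x r) y *\<^sub>R w y)) \<partial>lebesgue)
        = (\<integral>\<^sup>+y. ennreal (norm (indicat_real (cball x r) y *\<^sub>R w y)) \<partial>lborel)"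
      by (rule nn_integral_completion)
    finally have *: "(\<integral>\<^sup>+y. ennreal (norm (indicat_real (cball x r) y *\<^sub>R w y)) \<partial>lborel) < \<infinity>" .
    have "(\<integral>\<^sup>+y\<in>ball x r. ennreal (g y) \<partial>lborel) \<le> (\<integral>\<^sup>+y. ennreal (norm (indicat_real (cball x r) y *\<^sub>R w y)) \<partial>lborel)"
    proof (rule nn_integral_mono_AE, use g(2) in eventually_elim)
      fix y assume "w y = g y"
      then show "ennreal (g y) * indicator (ball x r) y \<le> ennreal (norm (indicat_real (cball x r) y *\<^sub>R w y))"
        by (auto simp: indicator_def intro!: ennreal_leI)
    qed
    then show ?thesis using * by (rule le_less_trans)
  qed
  show ?thesis using that g g0 fin by simp
qed

text \<open>
  The inequality \<open>measure_powr_le_dual_integrals\<close> on the small ball bounds its Lebesgue measure by its \<open>g\<close>-measure and the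
  integral of \<open>g powr (1 / (1 - p))\<close>.  The latter increases when the small ball is replaced by the large
  one, where the Muckenhoupt condition bounds it by the reciprocal of the \<open>g\<close>-measure of the large ball.
\<close>

lemma Ap_doubling:
  fixes g w :: "real^'n \<Rightarrow> real"
  assumes gm [measurable]: "g \<in> borel_measurable borel" and ae: "AE x in lborel. w x = g x"
    and pos: "AE x in lborel. 0 < g x" and fin: "\<And>x r. (\<integral>\<^sup>+y\<in>ball x r. ennreal (g y) \<partial>lborel) < \<infinity>"
    and p: "1 < p" and A: "Ap_const p w = ennreal A" "0 \<le> A"
  shows "doubling_measure (density lborel (\<lambda>x. ennreal (g x))) (A * (2 * 8 ^ CARD('n)) powr p)"
proof
  let ?\<mu> = "density lborel (\<lambda>x. ennreal (g x))"
  show "sets ?\<mu> = sets borel" by simp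
  have [measurable]: "ball x r \<in> sets borel" for x :: "real^'n" and r by simp
  have em: "emeasure ?\<mu> (ball x r) = (\<integral>\<^sup>+y\<in>ball x r. ennreal (g y) \<partial>lborel)" for x r
    by (rule emeasure_density) auto
  show fin': "emeasure ?\<mu> (ball x r) < \<infinity>" for x r using fin em by simp
  show pos': "0 < emeasure ?\<mu> (ball x r)" if "0 < r" for x r
  proof (rule ccontr)
    assume "\<not> 0 < emeasure ?\<mu> (ball x r)"
    then have "(\<integral>\<^sup>+y\<in>ball x r. ennreal (g y) \<partial>lborel) = 0" by (simp add: em)
    then have "AE y in lborel. ennreal (g y) * indicator (ball x r) y = 0"
      by (subst (asm) nn_integral_0_iff_AE) measurable
    with pos have "AE y in lborel. y \<notin> ball x r"
      by eventually_elim (auto split: split_indicator_asm)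
    then have "emeasure lborel (ball x r) = 0" by (subst (asm) AE_iff_measurable[of "ball x r"]) auto
    then show False using that unit_ball_vol_pos[of "real CARD('n)"] by (simp add: emeasure_ball)
  qed
  fix a b :: "real^'n" and r :: real assume r: "0 < r" and sub: "ball a r \<subseteq> ball b (8 * r)"
  let ?B = "ball a r" and ?B' = "ball b (8 * r)" and ?\<sigma> = "\<lambda>x. g x powr (1 / (1 - p))"
  obtain \<alpha> where \<alpha>: "(\<integral>\<^sup>+y\<in>?B. ennreal (g y) \<partial>lborel) = ennreal \<alpha>" "0 < \<alpha>"
    using obtain_positive_real[OF pos'[OF r, of a] fin'] unfolding em .
  obtain \<alpha>' where \<alpha>': "(\<integral>\<^sup>+y\<in>?B'. ennreal (g y) \<partial>lborel) = ennreal \<alpha>'" "0 < \<alpha>'"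
    using obtain_positive_real[OF pos'[of "8 * r" b] fin'] r unfolding em by auto
  define c where "c = unit_ball_vol (real CARD('n)) * r ^ CARD('n)"
  have c: "0 < c" using r by (simp add: c_def)
  have mB: "emeasure lborel ?B = ennreal c" using r by (simp add: emeasure_ball c_def)
  have mB': "emeasure lborel ?B' = ennreal (8 ^ CARD('n) * c)"
    using r by (simp add: emeasure_ball c_def power_mult_distrib mult_ac)
  have avw: "average ?B' w = ennreal \<alpha>' / ennreal (8 ^ CARD('n) * c)"
  proof -
    have "(\<integral>\<^sup>+x\<in>?B'. ennreal (w x) \<partial>lborel) = (\<integral>\<^sup>+x\<in>?B'. ennreal (g x) \<partial>lborel)"
      by (rule nn_integral_cong_AE, use ae in eventually_elim) simp
    then show ?thesis by (simp add: average_def nn_integral_completion mB' \<alpha>'(1))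
  qed
  have avs: "average ?B' (\<lambda>x. w x powr (1 / (1 - p))) = (\<integral>\<^sup>+x\<in>?B'. ennreal (?\<sigma> x) \<partial>lborel) / ennreal (8 ^ CARD('n) * c)"
  proof -
    have "(\<integral>\<^sup>+x\<in>?B'. ennreal (w x powr (1 / (1 - p))) \<partial>lborel) = (\<integral>\<^sup>+x\<in>?B'. ennreal (?\<sigma> x) \<partial>lborel)"
      by (rule nn_integral_cong_AE, use ae in eventually_elim) simp
    then show ?thesis by (simp add: average_def nn_integral_completion mB')
  qed
  have Ale: "average ?B' w * epowr (average ?B' (\<lambda>x. w x powr (1 / (1 - p)))) (p - 1) \<le> ennreal A"
    unfolding A(1)[symmetric] Ap_const_def using r
    by (intro SUP_upper) (auto intro!: exI[of _ b] exI[of _ "8 * r"])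
  have avw0: "average ?B' w = ennreal (\<alpha>' / (8 ^ CARD('n) * c))"
    unfolding avw using \<alpha>'(2) c by (intro divide_ennreal) auto
  have "(\<integral>\<^sup>+x\<in>?B'. ennreal (?\<sigma> x) \<partial>lborel) \<noteq> \<infinity>"
  proof
    assume "(\<integral>\<^sup>+x\<in>?B'. ennreal (?\<sigma> x) \<partial>lborel) = \<infinity>"
    then have "average ?B' (\<lambda>x. w x powr (1 / (1 - p))) = \<infinity>" unfolding avs by (simp add: ennreal_top_divide)
    then show False using Ale \<alpha>'(2) c unfolding avw0 by (simp add: epowr_def ennreal_mult_top top_unique)
  qed
  then obtain \<beta>' where \<beta>': "(\<integral>\<^sup>+x\<in>?B'. ennreal (?\<sigma> x) \<partial>lborel) = ennreal \<beta>'" "0 \<le> \<beta>'"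
    by (cases "\<integral>\<^sup>+x\<in>?B'. ennreal (?\<sigma> x) \<partial>lborel") auto
  have le: "(\<integral>\<^sup>+x\<in>?B. ennreal (?\<sigma> x) \<partial>lborel) \<le> ennreal \<beta>'"
    unfolding \<beta>'(1)[symmetric] using sub by (intro nn_integral_mono) (auto split: split_indicator)
  then obtain \<beta> where \<beta>: "(\<integral>\<^sup>+x\<in>?B. ennreal (?\<sigma> x) \<partial>lborel) = ennreal \<beta>" "0 \<le> \<beta>"
    by (cases "\<integral>\<^sup>+x\<in>?B. ennreal (?\<sigma> x) \<partial>lborel") (auto simp: top_unique)
  have \<beta>le: "\<beta> \<le> \<beta>'" using le \<beta> \<beta>' by simp
  have "(c / 2) powr p \<le> \<alpha> * \<beta> powr (p - 1)"
    by (rule measure_powr_le_dual_integrals[OF gm _ pos p \<alpha> \<beta> mB c]) simp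
  also have "\<dots> \<le> \<alpha> * \<beta>' powr (p - 1)"
    using \<beta>le \<beta>(2) p \<alpha>(2) by (intro mult_left_mono powr_mono2) auto
  finally have 1: "(c / 2) powr p \<le> \<alpha> * \<beta>' powr (p - 1)" .
  let ?m = "8 ^ CARD('n) * c"
  have m: "0 < ?m" using c by simp
  have "average ?B' (\<lambda>x. w x powr (1 / (1 - p))) = ennreal (\<beta>' / ?m)"
    unfolding avs \<beta>'(1) using \<beta>'(2) m by (intro divide_ennreal) auto
  then have "ennreal (\<alpha>' / ?m) * ennreal ((\<beta>' / ?m) powr (p - 1)) \<le> ennreal A"
    using Ale \<beta>'(2) m unfolding avw0 by (simp add: epowr_def)
  then have "\<alpha>' / ?m * (\<beta>' / ?m) powr (p - 1) \<le> A"
    using A(2) \<alpha>'(2) m by (subst (asm) ennreal_mult[symmetric]) auto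
  moreover have "(\<beta>' / ?m) powr (p - 1) = \<beta>' powr (p - 1) / ?m powr (p - 1)"
    by (rule powr_divide)
  ultimately have "\<alpha>' * \<beta>' powr (p - 1) / (?m * ?m powr (p - 1)) \<le> A"
    by (simp only: times_divide_times_eq)
  then have "\<alpha>' * \<beta>' powr (p - 1) \<le> A * (?m * ?m powr (p - 1))"
    by (rule pos_divide_le_eq[THEN iffD1, rotated])
      (intro mult_pos_pos m powr_gt_zero[THEN iffD2] less_imp_neq[OF m, symmetric])
  also have "?m * ?m powr (p - 1) = ?m powr p" using powr_add[of ?m 1 "p - 1"] m by simp
  finally have 2: "\<alpha>' * \<beta>' powr (p - 1) \<le> A * ?m powr p" .
  have "\<alpha>' * (c / 2) powr p \<le> \<alpha>' * (\<alpha> * \<beta>' powr (p - 1))" using 1 \<alpha>'(2) by (intro mult_left_mono) auto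
  also have "\<dots> = \<alpha> * (\<alpha>' * \<beta>' powr (p - 1))" by simp
  also have "\<dots> \<le> \<alpha> * (A * ?m powr p)" using 2 \<alpha>(2) by (intro mult_left_mono) auto
  also have "?m powr p = (2 * 8 ^ CARD('n)) powr p * (c / 2) powr p"
    using c by (subst powr_mult[symmetric]) auto
  finally have "\<alpha>' * (c / 2) powr p \<le> (A * (2 * 8 ^ CARD('n)) powr p * \<alpha>) * (c / 2) powr p" by (simp add: mult_ac)
  moreover have "0 < (c / 2) powr p" using c by simp
  ultimately have "\<alpha>' \<le> A * (2 * 8 ^ CARD('n)) powr p * \<alpha>" by (rule mult_right_le_imp_le)
  then have "ennreal \<alpha>' \<le> ennreal (A * (2 * 8 ^ CARD('n)) powr p) * ennreal \<alpha>"
    using A(2) \<alpha>(2) by (subst ennreal_mult[symmetric]) (auto intro!: ennreal_leI)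
  then show "emeasure ?\<mu> ?B' \<le> ennreal (A * (2 * 8 ^ CARD('n)) powr p) * emeasure ?\<mu> ?B"
    unfolding em \<alpha>(1) \<alpha>'(1) .
qed

text \<open>
  The exceptional set is contained in a Borel null set of the product, to which Tonelli's theorem
  applies.
\<close>

lemma AE_lebesgue_imp_AE_sections:
  assumes "AE z in (lebesgue :: ((real^'n) \<times> (real^'n)) measure). P (fst z) (snd z)"
  shows "AE y in lborel. AE x in lborel. P x y"
proof -
  have "AE z in lborel \<Otimes>\<^sub>M lborel. P (fst z) (snd z)"
    unfolding lborel_prod using assms by (simp only: AE_completion_iff)
  then obtain N where N: "N \<in> sets (lborel \<Otimes>\<^sub>M lborel)" "emeasure (lborel \<Otimes>\<^sub>M lborel) N = 0"
    "{z \<in> space (lborel \<Otimes>\<^sub>M lborel). \<not> P (fst z) (snd z)} \<subseteq> N"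
    by (rule AE_E) blast
  have imp: "P x y" if "(x, y) \<notin> N" for x y using subsetD[OF N(3), of "(x, y)"] that by (auto simp: space_pair_measure)
  have "AE z in lborel \<Otimes>\<^sub>M lborel. z \<notin> N"
    by (rule AE_not_in) (use N in \<open>auto simp: null_sets_def\<close>)
  then have "AE x in lborel. AE y in lborel. (x, y) \<notin> N" by (rule lborel_pair.AE_pair)
  moreover have "{z \<in> space (lborel \<Otimes>\<^sub>M lborel). (fst z, snd z) \<notin> N} \<in> sets (lborel \<Otimes>\<^sub>M lborel)"
    using sets.compl_sets[OF N(1)] by (simp add: set_diff_eq)
  ultimately have "AE y in lborel. AE x in lborel. (x, y) \<notin> N"
    by (subst (asm) lborel_pair.AE_commute)
  then show ?thesis
    by (rule eventually_mono) (erule eventually_mono, erule imp)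
qed

text \<open>
  The two densities in the kernel are absorbed into the two integrations with respect to \<open>\<mu>\<close>.
\<close>

lemma weighted_double_integral:
  fixes g v :: "real^'n \<Rightarrow> real"
  assumes dm: "doubling_measure (density lborel (\<lambda>x. ennreal (g x))) D"
    and gm [measurable]: "g \<in> borel_measurable borel" and vm [measurable]: "v \<in> borel_measurable borel"
  shows "(\<integral>\<^sup>+y. (\<integral>\<^sup>+x. ennreal ((\<bar>v x - v y\<bar> / norm (x - y) powr s) powr p)
      * (ennreal c * (ennreal (g x) * ennreal (g y) / emeasure (density lborel (\<lambda>x. ennreal (g x))) (midball x y))) \<partial>lborel) \<partial>lborel)
    = ennreal c * doubling_measure.energy\<mu> (density lborel (\<lambda>x. ennreal (g x))) p v s"
proof -
  define \<mu> where "\<mu> = density lborel (\<lambda>x. ennreal (g x))"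
  interpret doubling_measure \<mu> D unfolding \<mu>_def by (rule dm)
  define Q where "Q x y = ennreal ((\<bar>v x - v y\<bar> / norm (x - y) powr s) powr p) / emeasure \<mu> (midball x y)" for x y
  have Qs: "Q x y = Q y x" for x y by (simp add: Q_def midball_commute abs_minus_commute norm_minus_commute)
  have [measurable]: "v \<in> borel_measurable \<mu>" by (simp add: \<mu>_def)
  have [measurable]: "fst \<in> borel_measurable (\<mu> \<Otimes>\<^sub>M \<mu>)" "snd \<in> borel_measurable (\<mu> \<Otimes>\<^sub>M \<mu>)"
    by (subst measurable_cong_sets[OF refl sets_eq_borel[symmetric]], simp)+
  have Qm: "(\<lambda>z. Q (fst z) (snd z)) \<in> borel_measurable (\<mu> \<Otimes>\<^sub>M \<mu>)" unfolding Q_def by measurable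
  have [measurable]: "(\<lambda>y. \<integral>\<^sup>+x. Q y x \<partial>\<mu>) \<in> borel_measurable lborel"
    using borel_measurable_nn_integral_fst[OF Qm] by (simp add: \<mu>_def)
  have [measurable]: "(\<lambda>x. Q y x) \<in> borel_measurable lborel" for y
  proof -
    have "Pair y \<in> \<mu> \<rightarrow>\<^sub>M \<mu> \<Otimes>\<^sub>M \<mu>" by (rule measurable_Pair1') (simp add: \<mu>_def)
    from measurable_compose[OF this Qm] show ?thesis by (simp add: \<mu>_def)
  qed
  have "(\<integral>\<^sup>+y. (\<integral>\<^sup>+x. ennreal ((\<bar>v x - v y\<bar> / norm (x - y) powr s) powr p)
      * (ennreal c * (ennreal (g x) * ennreal (g y) / emeasure \<mu> (midball x y))) \<partial>lborel) \<partial>lborel)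
    = (\<integral>\<^sup>+y. (\<integral>\<^sup>+x. (ennreal c * ennreal (g y)) * (ennreal (g x) * Q y x) \<partial>lborel) \<partial>lborel)"
    by (intro nn_integral_cong, subst Qs) (simp only: Q_def divide_ennreal_def mult_ac)
  also have "\<dots> = (\<integral>\<^sup>+y. (ennreal c * ennreal (g y)) * (\<integral>\<^sup>+x. ennreal (g x) * Q y x \<partial>lborel) \<partial>lborel)"
    by (intro nn_integral_cong nn_integral_cmult) measurable
  also have "\<dots> = (\<integral>\<^sup>+y. ennreal c * (ennreal (g y) * (\<integral>\<^sup>+x. Q y x \<partial>\<mu>)) \<partial>lborel)"
  proof (intro nn_integral_cong)
    fix y
    have "(\<integral>\<^sup>+x. ennreal (g x) * Q y x \<partial>lborel) = (\<integral>\<^sup>+x. Q y x \<partial>\<mu>)"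
      unfolding \<mu>_def by (rule nn_integral_density[symmetric]) measurable
    then show "(ennreal c * ennreal (g y)) * (\<integral>\<^sup>+x. ennreal (g x) * Q y x \<partial>lborel) = ennreal c * (ennreal (g y) * (\<integral>\<^sup>+x. Q y x \<partial>\<mu>))"
      by (simp only: mult.assoc)
  qed
  also have "\<dots> = ennreal c * (\<integral>\<^sup>+y. ennreal (g y) * (\<integral>\<^sup>+x. Q y x \<partial>\<mu>) \<partial>lborel)"
    by (rule nn_integral_cmult) measurable
  also have "(\<integral>\<^sup>+y. ennreal (g y) * (\<integral>\<^sup>+x. Q y x \<partial>\<mu>) \<partial>lborel) = (\<integral>\<^sup>+y. (\<integral>\<^sup>+x. Q y x \<partial>\<mu>) \<partial>\<mu>)"
    by (subst (2) \<mu>_def) (rule nn_integral_density[symmetric], measurable)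
  also have "\<dots> = energy\<mu> p v s" by (simp add: energy\<mu>_def Q_def)
  finally show ?thesis unfolding \<mu>_def .
qed

text \<open>
  The bounds on the kernel hold for almost every pair, hence for almost every \<open>y\<close> and almost every \<open>x\<close>.
\<close>

lemma energy_sandwich:
  fixes g w v :: "real^'n \<Rightarrow> real"
  assumes dm: "doubling_measure (density lborel (\<lambda>x. ennreal (g x))) D"
    and gm [measurable]: "g \<in> borel_measurable borel" and vm: "v \<in> borel_measurable borel"
    and ae: "AE x in lborel. w x = g x"
    and k: "admissible_kernel lam Lam w k"
  shows "ennreal lam * (ennreal (s * (1 - s)) * doubling_measure.energy\<mu> (density lborel (\<lambda>x. ennreal (g x))) p v s) \<le> energy p k v s"
    and "energy p k v s \<le> ennreal Lam * (ennreal (s * (1 - s)) * doubling_measure.energy\<mu> (density lborel (\<lambda>x. ennreal (g x))) p v s)"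
proof -
  define \<mu> where "\<mu> = density lborel (\<lambda>x. ennreal (g x))"
  let ?K = "\<lambda>x y. ennreal (g x) * ennreal (g y) / emeasure \<mu> (midball x y)"
  let ?Q = "\<lambda>x y. (\<bar>v x - v y\<bar> / norm (x - y) powr s) powr p"
  have wm: "wmeasure w (midball x y) = emeasure \<mu> (midball x y)" for x y
  proof -
    have "wmeasure w (midball x y) = (\<integral>\<^sup>+z\<in>midball x y. ennreal (g z) \<partial>lborel)"
      unfolding wmeasure_def nn_integral_completion
      by (rule nn_integral_cong_AE, use ae in eventually_elim) simp
    also have "\<dots> = emeasure \<mu> (midball x y)"
      unfolding \<mu>_def by (rule emeasure_density[symmetric]) (auto simp: midball_def)
    finally show ?thesis .
  qed
  have "AE z in lebesgue. ennreal lam * (ennreal (w (fst z)) * ennreal (w (snd z)) / wmeasure w (midball (fst z) (snd z))) \<le> ennreal (k (fst z) (snd z))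
     \<and> ennreal (k (fst z) (snd z)) \<le> ennreal Lam * (ennreal (w (fst z)) * ennreal (w (snd z)) / wmeasure w (midball (fst z) (snd z)))"
    using k by (simp add: admissible_kernel_def case_prod_beta)
  from AE_lebesgue_imp_AE_sections[OF this]
  have "AE y in lborel. AE x in lborel. ennreal lam * (ennreal (w x) * ennreal (w y) / wmeasure w (midball x y)) \<le> ennreal (k x y)
     \<and> ennreal (k x y) \<le> ennreal Lam * (ennreal (w x) * ennreal (w y) / wmeasure w (midball x y))" .
  with ae have AEk: "AE y in lborel. AE x in lborel. ennreal lam * ?K x y \<le> ennreal (k x y) \<and> ennreal (k x y) \<le> ennreal Lam * ?K x y"
  proof eventually_elim
    case (elim y)
    from elim(2) ae show ?case by eventually_elim (use elim(1) in \<open>simp add: wm\<close>)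
  qed
  have en: "energy p k v s = ennreal (s * (1 - s)) * (\<integral>\<^sup>+y. (\<integral>\<^sup>+x. ennreal (?Q x y) * ennreal (k x y) \<partial>lborel) \<partial>lborel)"
    unfolding energy_def nn_integral_completion by (simp only: ennreal_mult'[OF powr_ge_zero])
  have "ennreal lam * doubling_measure.energy\<mu> \<mu> p v s \<le> (\<integral>\<^sup>+y. (\<integral>\<^sup>+x. ennreal (?Q x y) * ennreal (k x y) \<partial>lborel) \<partial>lborel)"
    unfolding \<mu>_def weighted_double_integral[OF dm gm vm, symmetric] unfolding \<mu>_def[symmetric]
  proof (rule nn_integral_mono_AE, use AEk in eventually_elim)
    fix y assume *: "AE x in lborel. ennreal lam * ?K x y \<le> ennreal (k x y) \<and> ennreal (k x y) \<le> ennreal Lam * ?K x y"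
    show "(\<integral>\<^sup>+x. ennreal (?Q x y) * (ennreal lam * ?K x y) \<partial>lborel) \<le> (\<integral>\<^sup>+x. ennreal (?Q x y) * ennreal (k x y) \<partial>lborel)"
      by (rule nn_integral_mono_AE, use * in eventually_elim) (auto intro: mult_left_mono)
  qed
  then have "ennreal (s * (1 - s)) * (ennreal lam * doubling_measure.energy\<mu> \<mu> p v s) \<le> energy p k v s"
    unfolding en by (intro mult_left_mono) auto
  then show "ennreal lam * (ennreal (s * (1 - s)) * doubling_measure.energy\<mu> (density lborel (\<lambda>x. ennreal (g x))) p v s) \<le> energy p k v s"
    unfolding \<mu>_def by (simp only: mult.left_commute)
  have "(\<integral>\<^sup>+y. (\<integral>\<^sup>+x. ennreal (?Q x y) * ennreal (k x y) \<partial>lborel) \<partial>lborel) \<le> ennreal Lam * doubling_measure.energy\<mu> \<mu> p v s"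
    unfolding \<mu>_def weighted_double_integral[OF dm gm vm, symmetric] unfolding \<mu>_def[symmetric]
  proof (rule nn_integral_mono_AE, use AEk in eventually_elim)
    fix y assume *: "AE x in lborel. ennreal lam * ?K x y \<le> ennreal (k x y) \<and> ennreal (k x y) \<le> ennreal Lam * ?K x y"
    show "(\<integral>\<^sup>+x. ennreal (?Q x y) * ennreal (k x y) \<partial>lborel) \<le> (\<integral>\<^sup>+x. ennreal (?Q x y) * (ennreal Lam * ?K x y) \<partial>lborel)"
      by (rule nn_integral_mono_AE, use * in eventually_elim) (auto intro: mult_left_mono)
  qed
  then have "energy p k v s \<le> ennreal (s * (1 - s)) * (ennreal Lam * doubling_measure.energy\<mu> \<mu> p v s)"
    unfolding en by (intro mult_left_mono) auto
  then show "energy p k v s \<le> ennreal Lam * (ennreal (s * (1 - s)) * doubling_measure.energy\<mu> (density lborel (\<lambda>x. ennreal (g x))) p v s)"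
    unfolding \<mu>_def by (simp only: mult.left_commute)
qed

lemma nn_integral_weight:
  fixes g w h :: "real^'n \<Rightarrow> real"
  assumes [measurable]: "g \<in> borel_measurable borel" "h \<in> borel_measurable borel"
    and ae: "AE x in lborel. w x = g x" and h: "\<And>x. 0 \<le> h x"
  shows "(\<integral>\<^sup>+x. ennreal (h x * w x) \<partial>lebesgue) = (\<integral>\<^sup>+x. ennreal (h x) \<partial>density lborel (\<lambda>x. ennreal (g x)))"
proof -
  have "(\<integral>\<^sup>+x. ennreal (h x * w x) \<partial>lebesgue) = (\<integral>\<^sup>+x. ennreal (g x) * ennreal (h x) \<partial>lborel)"
    unfolding nn_integral_completion
    by (rule nn_integral_cong_AE, use ae in eventually_elim) (simp only: ennreal_mult''[OF h] mult.commute)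
  also have "\<dots> = (\<integral>\<^sup>+x. ennreal (h x) \<partial>density lborel (\<lambda>x. ennreal (g x)))"
    by (rule nn_integral_density[symmetric]) measurable
  finally show ?thesis .
qed

section \<open>The two limits of the nonlocal energy\<close>

theorem theorem2p6:
  fixes p lam Lam :: real and A :: ennreal
  assumes "CARD('n::finite) \<ge> 2"
    and "1 < p"
    and "0 < lam" and "lam \<le> Lam"
  shows "\<exists>C::real. 1 \<le> C \<and>
    (\<forall>(w :: real^'n \<Rightarrow> real) k v.
       w \<in> Ap p \<longrightarrow> Ap_const p w = A \<longrightarrow> admissible_kernel lam Lam w k \<longrightarrow> v \<in> Cc_infty \<longrightarrow>
         ennreal (inverse C) * (\<integral>\<^sup>+x. ennreal (\<bar>v x\<bar> powr p * w x) \<partial>lebesgue)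
           \<le> Liminf (at_right 0) (energy p k v) \<and>
         Liminf (at_right 0) (energy p k v) \<le> Limsup (at_right 0) (energy p k v) \<and>
         Limsup (at_right 0) (energy p k v)
           \<le> ennreal C * (\<integral>\<^sup>+x. ennreal (\<bar>v x\<bar> powr p * w x) \<partial>lebesgue) \<and>
         ennreal (inverse C) * (\<integral>\<^sup>+x. ennreal (norm (grad v x) powr p * w x) \<partial>lebesgue)
           \<le> Liminf (at_left 1) (energy p k v) \<and>
         Liminf (at_left 1) (energy p k v) \<le> Limsup (at_left 1) (energy p k v) \<and>
         Limsup (at_left 1) (energy p k v)
           \<le> ennreal C * (\<integral>\<^sup>+x. ennreal (norm (grad v x) powr p * w x) \<partial>lebesgue))"
proof -
  define D where "D = enn2real A * (2 * 8 ^ CARD('n)) powr p"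
  \<comment> \<open>the reciprocal of the limit of \<open>t * dyadic_coeff p c t\<close>\<close>
  define L where "L = p * ln (2::real)"
  \<comment> \<open>the four constants of \<open>energy_limits\<close>, with the reciprocals of those in the lower bounds\<close>
  define C where "C = Max {1, D * L / lam, D * L / (lam * 4 powr (- p)), 2 * Lam * 2 powr p * D / L, Lam * 2 powr p * D / L}"
  have L: "0 < L" using assms(2) by (simp add: L_def)
  have C: "1 \<le> C" "D * L / lam \<le> C" "D * L / (lam * 4 powr (- p)) \<le> C" "2 * Lam * 2 powr p * D / L \<le> C" "Lam * 2 powr p * D / L \<le> C"
    unfolding C_def by (rule Max_ge; simp)+
  show ?thesis
  proof (intro exI[of _ C] conjI C(1) allI impI)
    fix w :: "real^'n \<Rightarrow> real" and k :: "real^'n \<Rightarrow> real^'n \<Rightarrow> real" and v :: "real^'n \<Rightarrow> real"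
    assume w: "w \<in> Ap p" "Ap_const p w = A" and k: "admissible_kernel lam Lam w k" and v: "v \<in> Cc_infty"
    show "Liminf (at_right 0) (energy p k v) \<le> Limsup (at_right 0) (energy p k v)"
      "Liminf (at_left 1) (energy p k v) \<le> Limsup (at_left 1) (energy p k v)"
      by (auto intro: Liminf_le_Limsup)
    have "weight w" "A < \<infinity>" using w by (auto simp: Ap_def)
    then have A: "Ap_const p w = ennreal (enn2real A)" "0 \<le> enn2real A" using w(2) by (auto simp: less_top)
    obtain g where g: "g \<in> borel_measurable borel" "AE x in lborel. w x = g x" "AE x in lborel. 0 < g x"
        "\<And>x r. (\<integral>\<^sup>+y\<in>ball x r. ennreal (g y) \<partial>lborel) < \<infinity>"
      using weight_borel_version[OF \<open>weight w\<close>] by blast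
    let ?\<mu> = "density lborel (\<lambda>x. ennreal (g x))"
    have dm: "doubling_measure ?\<mu> D"
      unfolding D_def by (rule Ap_doubling[OF g assms(2) A])
    interpret doubling_measure ?\<mu> D by (rule dm)
    have vm: "v \<in> borel_measurable borel" "(\<lambda>x. \<bar>v x\<bar> powr p) \<in> borel_measurable borel"
      "(\<lambda>x. norm (grad v x) powr p) \<in> borel_measurable borel"
      using Cc_infty_continuous[OF v, THEN borel_measurable_continuous_onI] by measurable
    have I: "(\<integral>\<^sup>+x. ennreal (\<bar>v x\<bar> powr p * w x) \<partial>lebesgue) = (\<integral>\<^sup>+x. ennreal (\<bar>v x\<bar> powr p) \<partial>?\<mu>)"
      "(\<integral>\<^sup>+x. ennreal (norm (grad v x) powr p * w x) \<partial>lebesgue) = (\<integral>\<^sup>+x. ennreal (norm (grad v x) powr p) \<partial>?\<mu>)"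
      using nn_integral_weight[OF g(1) vm(2) g(2)] nn_integral_weight[OF g(1) vm(3) g(2)] by simp_all
    have "0 < p" "0 < Lam" using assms by auto
    note lim = energy_limits[OF v \<open>0 < p\<close> assms(3) \<open>0 < Lam\<close>
        energy_sandwich(1)[OF dm g(1) vm(1) g(2) k] energy_sandwich(2)[OF dm g(1) vm(1) g(2) k], folded L_def]
    have inv: "ennreal (inverse C) * X \<le> Y" if "ennreal b * X \<le> Y" "inverse C \<le> b" for b X and Y :: ennreal
      using that(1) by (rule order_trans[rotated]) (intro mult_right_mono ennreal_leI that(2), simp)
    have up: "Y \<le> ennreal C * X" if "Y \<le> ennreal b * X" "b \<le> C" for b X and Y :: ennreal
      using that(1) by (rule order_trans) (intro mult_right_mono ennreal_leI that(2), simp)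
    have "inverse C \<le> inverse (D * L / lam)" "inverse C \<le> inverse (D * L / (lam * 4 powr (- p)))"
      using C D_pos L assms(3) by (intro le_imp_inverse_le; simp)+
    then have i: "inverse C \<le> lam / (D * L)" "inverse C \<le> lam * 4 powr (- p) / (D * L)" by simp_all
    show "ennreal (inverse C) * (\<integral>\<^sup>+x. ennreal (\<bar>v x\<bar> powr p * w x) \<partial>lebesgue) \<le> Liminf (at_right 0) (energy p k v)"
      unfolding I by (rule inv[OF lim(1) i(1)])
    show "Limsup (at_right 0) (energy p k v) \<le> ennreal C * (\<integral>\<^sup>+x. ennreal (\<bar>v x\<bar> powr p * w x) \<partial>lebesgue)"
      unfolding I by (rule up[OF lim(2) C(4)])
    show "ennreal (inverse C) * (\<integral>\<^sup>+x. ennreal (norm (grad v x) powr p * w x) \<partial>lebesgue) \<le> Liminf (at_left 1) (energy p k v)"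
      unfolding I by (rule inv[OF lim(3) i(2)])
    show "Limsup (at_left 1) (energy p k v) \<le> ennreal C * (\<integral>\<^sup>+x. ennreal (norm (grad v x) powr p * w x) \<partial>lebesgue)"
      unfolding I by (rule up[OF lim(4) C(5)])
  qed
qed

end
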